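(* Let $\mathbb K\in\{\mathbb R,\mathbb C\}$, let $p\geq1$ be an integer, and assume $K(z,w)$ is a $\mathbb K^{p\times p}$-valued positive definite function in $\mathbb K$, entire in the variables $z$ and $\overline w$. Then the reproducing kernel Hilbert space $\mathcal H(\mathscr K)$ of $\ell_2(\mathbb N_0,\mathbb K^p)$-valued functions on $\mathbb K$ associated to the kernel $\mathscr K(z,w)$ is the space of jet functions $J(f)$ generated by the elements $f$ of $\mathcal H(K)$, with inner product $$\langle J(f),J(g)\rangle_{\mathcal H(\mathscr K)}=\langle f,g\rangle_{\mathcal H(K)},\qquad f,g\in\mathcal H(K).$$
   Context: $\ell_2(\mathbb N_0,\mathbb K^p)$ is the Hilbert space of sequences $(\xi_n)_{n=0}^\infty$ in $\mathbb K^p$ with $\sum_n\|\xi_n\|^2<\infty$. "Entire in $z$ and $\overline w$" means that $K(z,w)$ is given by a power series in $z$ and $\overline w$ converging on all of $\mathbb K^2$ (for $\mathbb K=\mathbb R$, $\overline w=w$). A matrix- or operator-valued kernel $L(z,w)$ acting on a Hilbert space $\mathcal E$ is positive definite in $\mathbb K$ if $((z,f),(w,e))\mapsto\langle L(z,w)e,f\rangle_{\mathcal E}$ is a (Hermitian) positive semidefinite scalar kernel on $\mathbb K\times\mathcal E$. $\mathcal H(K)$ is the reproducing kernel Hilbert space of $\mathbb K^p$-valued functions on $\mathbb K$ with reproducing kernel $K$; its elements are entire. $\mathscr K(z,w)$ is the bounded operator on $\ell_2(\mathbb N_0,\mathbb K^p)$ given by the semi-infinite block matrix with entries $$\mathscr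 K_{n,m}(z,w)=\frac1{m!\,n!}\frac{\partial^{n+m}K(z,w)}{\partial z^n\partial\overline w^m},\quad n,m=0,1,\ldots;$$ it is a positive definite operator-valued function of $z,w\in\mathbb K$. For $f\in\mathcal H(K)$, the jet function $J(f)$ is the function $z\mapsto J_z(f)=\big(\tfrac{f^{(n)}(z)}{n!}\big)_{n=0}^\infty\in\ell_2(\mathbb N_0,\mathbb K^p)$. *)

theory Defs
  imports "HOL-Analysis.Analysis" "HOL-Library.Function_Algebras"
begin

(* The scalar field: real or complex numbers with their conjugation. Lemma
   real_or_complex_dichotomy shows that the axioms admit nothing else. *)
class real_or_complex = real_normed_field + euclidean_space +
  fixes conjugate :: "'a \<Rightarrow> 'a"
  assumes conj_add: "conjugate (x + y) = conjugate x + conjugate y"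
    and conj_mult: "conjugate (x * y) = conjugate x * conjugate y"
    and conj_scaleR: "conjugate (r *\<^sub>R x) = r *\<^sub>R conjugate x"
    and mult_conj_scaleR: "x * conjugate x = (norm x)\<^sup>2 *\<^sub>R 1"
    and conj_fixed_scaleR: "conjugate x = x \<Longrightarrow> \<exists>r. x = r *\<^sub>R 1"

instantiation real :: real_or_complex
begin
definition conjugate_real :: "real \<Rightarrow> real" where "conjugate_real x = x"
instance
  by standard (auto simp: conjugate_real_def power2_eq_square)
end

instantiation complex :: real_or_complex
begin
definition conjugate_complex :: "complex \<Rightarrow> complex" where "conjugate_complex = cnj"
instance
proof
  show "x * conjugate x = (norm x)\<^sup>2 *\<^sub>R 1" for x :: complex
    by (simp add: conjugate_complex_def complex_norm_square scaleR_conv_of_real del: of_real_power)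
  show "\<exists>r. x = r *\<^sub>R 1" if "conjugate x = x" for x :: complex
    using that by (metis Reals_cases Reals_cnj_iff conjugate_complex_def of_real_def)
qed (auto simp: conjugate_complex_def)
end

lemma mult_conj: "x * conjugate x = of_real ((norm (x :: 'k::real_or_complex))\<^sup>2)"
  by (simp add: mult_conj_scaleR of_real_def del: of_real_power)

lemma conj_one: "conjugate (1 :: 'k::real_or_complex) = 1"
  using mult_conj_scaleR[of "1 :: 'k"] by simp

lemma conj_of_real: "conjugate (of_real r :: 'k::real_or_complex) = of_real r"
  by (simp add: of_real_def conj_scaleR conj_one)

lemma conj_fixed_imp_real: "conjugate (x :: 'k::real_or_complex) = x \<Longrightarrow> x \<in> \<real>"
  using conj_fixed_scaleR[of x] by (auto simp: Reals_def of_real_def)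

lemma conj_conj: "conjugate (conjugate x) = (x :: 'k::real_or_complex)"
proof (cases "x = 0")
  case True
  then show ?thesis using conj_of_real[of 0, where 'k='k] by simp
next
  case False
  have xx: "x * conjugate x \<noteq> 0"
    using False by (simp add: mult_conj)
  have "conjugate x * conjugate (conjugate x) = conjugate (x * conjugate x)" by (simp add: conj_mult)
  also have "\<dots> = conjugate x * x" by (metis mult_conj conj_of_real mult.commute)
  finally show ?thesis using xx by simp
qed

lemma conj_minus: "conjugate (x - y) = conjugate x - conjugate (y :: 'k::real_or_complex)"
  by (metis add_diff_cancel diff_add_cancel conj_add)

lemma real_or_complex_dichotomy:
  "(\<forall>x::'k::real_or_complex. x \<in> \<real> \<and> conjugate x = x) \<or>
   (\<exists>i::'k. i * i = -1 \<and> conjugate i = -i \<and> (\<forall>x. \<exists>a b. x = of_real a + of_real b * i))"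
proof (cases "\<forall>x::'k. conjugate x = x")
  case True
  then show ?thesis using conj_fixed_imp_real by auto
next
  case False
  then obtain x0 :: 'k where x0: "conjugate x0 \<noteq> x0" by blast
  define j where "j = x0 - conjugate x0"
  have j0: "j \<noteq> 0" and cj: "conjugate j = - j"
    using x0 by (auto simp: j_def conj_minus conj_conj)
  define i where "i = j / of_real (norm j)"
  have nr: "(of_real (norm j) :: 'k) \<noteq> 0" using j0 by simp
  have ij: "i * of_real (norm j) = j" using nr by (simp add: i_def)
  have ci: "conjugate i = - i"
  proof -
    have "conjugate i * of_real (norm j) = - i * of_real (norm j)"
      by (metis ij cj conj_mult conj_of_real mult_minus_left)
    then show ?thesis using nr mult_right_cancel by blast
  qed
  have ni: "norm i = 1" using j0 by (simp add: i_def norm_divide)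
  have ii: "i * i = -1"
    using mult_conj[of i] by (simp add: ci ni minus_equation_iff)
  have "\<exists>a b. x = of_real a + of_real b * i" for x :: 'k
  proof -
    have "x + conjugate x \<in> \<real>"
      by (rule conj_fixed_imp_real) (simp add: conj_add conj_conj add.commute)
    moreover have "(x - conjugate x) * i \<in> \<real>"
      by (rule conj_fixed_imp_real) (simp add: conj_minus conj_mult conj_conj ci algebra_simps)
    ultimately obtain a b where a: "x + conjugate x = of_real a" and b: "(x - conjugate x) * i = of_real b"
      by (auto simp: Reals_def)
    have "x - conjugate x = - ((x - conjugate x) * i) * i"
      using ii by (simp add: mult.assoc)
    then have "x - conjugate x = - of_real b * i" using b by simp
    then have "2 * x = of_real a + - of_real b * i" using a
      by (metis (no_types) add.commute add_diff_cancel_left' diff_add_cancel group_cancel.add1 mult_2)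
    then have "x = of_real (a/2) + of_real (-b/2) * i"
      by (simp add: field_simps)
    then show ?thesis by blast
  qed
  then show ?thesis using ii ci by blast
qed

(* Inner products are linear in the first argument. The library's (\<bullet>) is real-valued,
   hence these definitions. *)

definition vec_ip :: "'k::real_or_complex ^ 'p \<Rightarrow> 'k ^ 'p \<Rightarrow> 'k" where
  "vec_ip x y = (\<Sum>i\<in>UNIV. x $ i * conjugate (y $ i))"

definition l2 :: "(nat \<Rightarrow> 'k::real_or_complex ^ 'p) set" where
  "l2 = {\<xi>. summable (\<lambda>n. (norm (\<xi> n))\<^sup>2)}"

definition l2_ip :: "(nat \<Rightarrow> 'k::real_or_complex ^ 'p) \<Rightarrow> (nat \<Rightarrow> 'k ^ 'p) \<Rightarrow> 'k" where
  "l2_ip \<xi> \<eta> = (\<Sum>n. vec_ip (\<xi> n) (\<eta> n))"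

definition l2_scale :: "'k::real_or_complex \<Rightarrow> (nat \<Rightarrow> 'k ^ 'p) \<Rightarrow> (nat \<Rightarrow> 'k ^ 'p)" where
  "l2_scale c \<xi> = (\<lambda>n. c *s \<xi> n)"

definition psd_kernel_on :: "'x set \<Rightarrow> ('x \<Rightarrow> 'x \<Rightarrow> 'k::real_or_complex) \<Rightarrow> bool" where
  "psd_kernel_on X k \<longleftrightarrow>
     (\<forall>x\<in>X. \<forall>y\<in>X. k y x = conjugate (k x y)) \<and>
     (\<forall>F c. finite F \<and> F \<subseteq> X \<longrightarrow>
        (\<exists>r\<ge>0. (\<Sum>x\<in>F. \<Sum>y\<in>F. conjugate (c x) * k x y * c y) = of_real r))"

(* The values L z w act on the space E (a subset of the type 'e) with inner product ipE. *)
definition positive_definite ::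
  "'e set \<Rightarrow> ('e \<Rightarrow> 'e \<Rightarrow> 'k::real_or_complex) \<Rightarrow> ('k \<Rightarrow> 'k \<Rightarrow> 'e \<Rightarrow> 'e) \<Rightarrow> bool" where
  "positive_definite E ipE L \<longleftrightarrow>
     psd_kernel_on (UNIV \<times> E) (\<lambda>(z, f) (w, e). ipE (L z w e) f)"

(* A Hilbert space with carrier H inside an ambient vector space with scalar multiplication
   scl. The values of ip outside H are irrelevant. *)
definition hilbert_space_on ::
  "('k::real_or_complex \<Rightarrow> 'v::ab_group_add \<Rightarrow> 'v) \<Rightarrow> 'v set \<Rightarrow> ('v \<Rightarrow> 'v \<Rightarrow> 'k) \<Rightarrow> bool" where
  "hilbert_space_on scl H ip \<longleftrightarrow>
     module.subspace scl H \<and>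
     (\<forall>f\<in>H. \<forall>g\<in>H. \<forall>h\<in>H. ip (f + g) h = ip f h + ip g h) \<and>
     (\<forall>c. \<forall>f\<in>H. \<forall>h\<in>H. ip (scl c f) h = c * ip f h) \<and>
     (\<forall>f\<in>H. \<forall>g\<in>H. ip g f = conjugate (ip f g)) \<and>
     (\<forall>f\<in>H. \<exists>r\<ge>0. ip f f = of_real r) \<and>
     (\<forall>f\<in>H. ip f f = 0 \<longrightarrow> f = 0) \<and>
     (\<forall>X. (\<forall>n. X n \<in> H) \<and>
          (\<forall>\<epsilon>>0. \<exists>N. \<forall>m\<ge>N. \<forall>n\<ge>N. sqrt (norm (ip (X m - X n) (X m - X n))) < \<epsilon>) \<longrightarrow>
          (\<exists>x\<in>H. (\<lambda>n. sqrt (norm (ip (X n - x) (X n - x)))) \<longlonglongrightarrow> 0))"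

(* (H, ip) is the reproducing kernel Hilbert space of E-valued functions on the scalar field
   with reproducing kernel L. These conditions determine H, and ip on H, uniquely, and such a
   space exists for every positive definite L whose values are bounded linear operators. *)
definition is_rkhs ::
  "('k::real_or_complex \<Rightarrow> 'e::ab_group_add \<Rightarrow> 'e) \<Rightarrow> 'e set \<Rightarrow> ('e \<Rightarrow> 'e \<Rightarrow> 'k) \<Rightarrow>
   ('k \<Rightarrow> 'k \<Rightarrow> 'e \<Rightarrow> 'e) \<Rightarrow> ('k \<Rightarrow> 'e) set \<Rightarrow> (('k \<Rightarrow> 'e) \<Rightarrow> ('k \<Rightarrow> 'e) \<Rightarrow> 'k) \<Rightarrow> bool" where
  "is_rkhs scl E ipE L H ip \<longleftrightarrow>
     hilbert_space_on (\<lambda>c f z. scl c (f z)) H ip \<and>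
     (\<forall>f\<in>H. \<forall>z. f z \<in> E) \<and>
     (\<forall>w. \<forall>e\<in>E. (\<lambda>z. L z w e) \<in> H) \<and>
     (\<forall>f\<in>H. \<forall>w. \<forall>e\<in>E. ip f (\<lambda>z. L z w e) = ipE (f w) e)"

(* The library's summation over an index set without order is absolute convergence here,
   as usual for a power series in two variables. *)
definition entire_in_z_conj_w :: "('k::real_or_complex \<Rightarrow> 'k \<Rightarrow> 'k ^ 'p ^ 'p) \<Rightarrow> bool" where
  "entire_in_z_conj_w K \<longleftrightarrow>
     (\<exists>a :: nat \<Rightarrow> nat \<Rightarrow> 'k ^ 'p ^ 'p. \<forall>z w i j.
        ((\<lambda>(n, m). a n m $ i $ j * z ^ n * conjugate w ^ m) has_sum K z w $ i $ j) UNIV)"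

(* The derivative with respect to the conjugate variable of w at the point w is the ordinary
   derivative of u \<mapsto> K z (conjugate u) at u = conjugate w. *)
definition jet_kernel_entry ::
  "('k::real_or_complex \<Rightarrow> 'k \<Rightarrow> 'k ^ 'p ^ 'p) \<Rightarrow> nat \<Rightarrow> nat \<Rightarrow> 'k \<Rightarrow> 'k \<Rightarrow> 'k ^ 'p ^ 'p" where
  "jet_kernel_entry K n m z w = (\<chi> i j.
     (deriv ^^ n) (\<lambda>x. (deriv ^^ m) (\<lambda>u. K x (conjugate u) $ i $ j) (conjugate w)) z
       / (fact m * fact n))"

definition jet_kernel ::
  "('k::real_or_complex \<Rightarrow> 'k \<Rightarrow> 'k ^ 'p ^ 'p) \<Rightarrow> 'k \<Rightarrow> 'k \<Rightarrow> (nat \<Rightarrow> 'k ^ 'p) \<Rightarrow> (nat \<Rightarrow> 'k ^ 'p)" where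
  "jet_kernel K z w \<xi> = (\<lambda>n. \<Sum>m. jet_kernel_entry K n m z w *v \<xi> m)"

definition jet :: "('k::real_or_complex \<Rightarrow> 'k ^ 'p) \<Rightarrow> 'k \<Rightarrow> (nat \<Rightarrow> 'k ^ 'p)" where
  "jet f z = (\<lambda>n. \<chi> i. (deriv ^^ n) (\<lambda>x. f x $ i) z / fact n)"

end

theory Submission
  imports Defs
begin

text \<open>Everything rests on one observation: the entries of a jet are inner products. If the kernel is entire,
  there are elements \<open>F i z n\<close> of the space \<open>H\<close> such that for every \<open>f\<close> in \<open>H\<close> the \<open>i\<close>-th component of the \<open>n\<close>-th Taylor
  coefficient of \<open>f\<close> at \<open>z\<close> is \<open>ip f (F i z n)\<close>; formally, \<open>F i z n\<close> is the \<open>n\<close>-th derivative of the \<open>i\<close>-th kernel column with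
  respect to the conjugate variable, divided by \<open>fact n\<close>. Their norms are summable in \<open>n\<close>, and their Gram matrix is
  the jet kernel. Therefore jets of elements of \<open>H\<close> are square summable, and for a square summable sequence \<open>e\<close> the
  series \<open>\<Sum>m j. e m $ j \<cdot> F j w m\<close> converges in \<open>H\<close> to an element whose jet is the function
  \<open>z \<mapsto> jet_kernel K z w e\<close> and whose inner product with \<open>f\<close> is the pairing of \<open>jet f w\<close> with \<open>e\<close>. So the jets, with the inner
  product of \<open>H\<close> carried over by the injective linear map \<open>jet\<close>, form a reproducing kernel Hilbert space
  of the jet kernel (\<open>jet_kernel_preimage\<close>, \<open>is_rkhs_jets\<close>). As such a space is unique (\<open>rkhs_unique\<close>), it
  is the only one.

  The analytic core is the construction of \<open>F\<close>, where derivatives have to be taken inside \<open>H\<close>. The lemma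
  \<open>gram_power_series\<close> shows that a family of vectors whose Gram kernel is an entire double power series is itself
  an entire power series with coefficients in the Hilbert space; the coefficients are found
  recursively as limits of remainder quotients, by an argument that serves the real and the complex
  case alike. Termwise differentiation then yields \<open>F\<close> (\<open>jet_functionals\<close>).\<close>

section \<open>Conjugation\<close>

lemma norm_conjugate [simp]: "norm (conjugate x) = norm (x :: 'k::real_or_complex)"
proof (cases "x = 0")
  case True
  then show ?thesis using conj_of_real[of 0, where 'k='k] by simp
next
  case False
  have "norm x * norm (conjugate x) = norm x * norm x"
    using arg_cong[OF mult_conj[of x], of norm] by (simp add: norm_mult power2_eq_square)
  with False show ?thesis by simp
qed

lemma conj_zero [simp]: "conjugate (0 :: 'k::real_or_complex) = 0"
  by (metis norm_conjugate norm_eq_zero)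

lemma bounded_linear_conjugate: "bounded_linear (conjugate :: 'k::real_or_complex \<Rightarrow> 'k)"
  by (rule bounded_linear_intro[where K = 1]) (auto simp: conj_add conj_scaleR)

lemma conj_sum: "conjugate (sum f A) = (\<Sum>x\<in>A. conjugate (f x :: 'k::real_or_complex))"
  by (rule linear_sum[OF bounded_linear.linear[OF bounded_linear_conjugate]])

lemma conj_power: "conjugate (x ^ n) = conjugate (x :: 'k::real_or_complex) ^ n"
  by (induction n) (auto simp: conj_one conj_mult)

lemmas conj_simps = conj_add conj_minus conj_mult conj_power conj_conj conj_one conj_of_real conj_sum

lemma conj_sums: "f sums (s :: 'k::real_or_complex) \<Longrightarrow> (\<lambda>n. conjugate (f n)) sums conjugate s"
  by (rule bounded_linear.sums[OF bounded_linear_conjugate])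

section \<open>Hilbert spaces on a carrier set\<close>

locale hilbert_space = module scl
  for scl :: "'k::real_or_complex \<Rightarrow> 'v::ab_group_add \<Rightarrow> 'v" +
  fixes H :: "'v set" and ip :: "'v \<Rightarrow> 'v \<Rightarrow> 'k"
  assumes hilbert: "hilbert_space_on scl H ip"
begin

definition nrm :: "'v \<Rightarrow> real" where "nrm f = sqrt (norm (ip f f))"

lemma subspace_H: "subspace H"
  by (rule hilbert[unfolded hilbert_space_on_def, THEN conjunct1])

lemmas mem = subspace_0[OF subspace_H] subspace_add[OF subspace_H] subspace_scale[OF subspace_H]
  subspace_diff[OF subspace_H] subspace_sum[OF subspace_H]

lemma ip_add_left: "f \<in> H \<Longrightarrow> g \<in> H \<Longrightarrow> h \<in> H \<Longrightarrow> ip (f + g) h = ip f h + ip g h"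
  using hilbert[unfolded hilbert_space_on_def, THEN conjunct2, THEN conjunct1] by blast

lemma ip_scale_left: "f \<in> H \<Longrightarrow> h \<in> H \<Longrightarrow> ip (scl c f) h = c * ip f h"
  using hilbert[unfolded hilbert_space_on_def, THEN conjunct2, THEN conjunct2, THEN conjunct1] by blast

lemma ip_sym: "f \<in> H \<Longrightarrow> g \<in> H \<Longrightarrow> ip g f = conjugate (ip f g)"
  using hilbert[unfolded hilbert_space_on_def, THEN conjunct2, THEN conjunct2, THEN conjunct2, THEN conjunct1] by blast

lemma ip_self: "f \<in> H \<Longrightarrow> ip f f = of_real ((nrm f)\<^sup>2)"
  using hilbert[unfolded hilbert_space_on_def, THEN conjunct2, THEN conjunct2, THEN conjunct2, THEN conjunct2, THEN conjunct1]
  by (force simp: nrm_def)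

lemma ip_eq_0_iff: "f \<in> H \<Longrightarrow> ip f f = 0 \<longleftrightarrow> f = 0"
  using hilbert[unfolded hilbert_space_on_def, THEN conjunct2, THEN conjunct2, THEN conjunct2, THEN conjunct2, THEN conjunct2, THEN conjunct1]
    ip_scale_left[of 0 0 0] mem(1) by auto

lemma complete:
  assumes "\<And>n. X n \<in> H" "\<And>\<epsilon>. \<epsilon> > 0 \<Longrightarrow> \<exists>N. \<forall>m\<ge>N. \<forall>n\<ge>N. nrm (X m - X n) < \<epsilon>"
  obtains x where "x \<in> H" "(\<lambda>n. nrm (X n - x)) \<longlonglongrightarrow> 0"
  using hilbert[unfolded hilbert_space_on_def, THEN conjunct2, THEN conjunct2, THEN conjunct2, THEN conjunct2, THEN conjunct2, THEN conjunct2, rule_format, of X]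
    assms unfolding nrm_def by blast

lemma nrm_nonneg [simp]: "nrm f \<ge> 0"
  by (simp add: nrm_def)

lemma nrm_eq_0_iff: "f \<in> H \<Longrightarrow> nrm f = 0 \<longleftrightarrow> f = 0"
  using ip_eq_0_iff by (simp add: nrm_def)

lemma ip_diff_left: "f \<in> H \<Longrightarrow> g \<in> H \<Longrightarrow> h \<in> H \<Longrightarrow> ip (f - g) h = ip f h - ip g h"
  using ip_add_left[of "f - g" g h] mem(4) by simp

lemma ip_add_right: "f \<in> H \<Longrightarrow> g \<in> H \<Longrightarrow> h \<in> H \<Longrightarrow> ip f (g + h) = ip f g + ip f h"
  by (metis ip_sym ip_add_left conj_add mem(2))

lemma ip_diff_right: "f \<in> H \<Longrightarrow> g \<in> H \<Longrightarrow> h \<in> H \<Longrightarrow> ip f (g - h) = ip f g - ip f h"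
  by (metis ip_sym ip_diff_left conj_minus mem(4))

lemma ip_scale_right: "f \<in> H \<Longrightarrow> g \<in> H \<Longrightarrow> ip f (scl c g) = conjugate c * ip f g"
  by (metis ip_sym ip_scale_left conj_mult mem(3))

lemma ip_zero_left: "f \<in> H \<Longrightarrow> ip 0 f = 0"
  using ip_scale_left[of 0 f 0] mem(1) by simp

lemma ip_zero_right: "f \<in> H \<Longrightarrow> ip f 0 = 0"
  using ip_scale_right[of f 0 0] mem(1) by simp

lemma ip_sum_left:
  "(\<And>x. x \<in> A \<Longrightarrow> F x \<in> H) \<Longrightarrow> g \<in> H \<Longrightarrow> ip (sum F A) g = (\<Sum>x\<in>A. ip (F x) g)"
  by (induction A rule: infinite_finite_induct) (auto simp: ip_zero_left ip_add_left mem)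

lemma ip_sum_right:
  "(\<And>x. x \<in> A \<Longrightarrow> F x \<in> H) \<Longrightarrow> g \<in> H \<Longrightarrow> ip g (sum F A) = (\<Sum>x\<in>A. ip g (F x))"
  by (induction A rule: infinite_finite_induct) (auto simp: ip_zero_right ip_add_right mem)

lemma nrm_scale: "f \<in> H \<Longrightarrow> nrm (scl c f) = norm c * nrm f"
  by (simp add: nrm_def ip_scale_left ip_scale_right mem norm_mult real_sqrt_mult)

lemma nrm_minus_commute: "f \<in> H \<Longrightarrow> g \<in> H \<Longrightarrow> nrm (f - g) = nrm (g - f)"
  using nrm_scale[of "g - f" "-1"] mem(4)[of g f] by simp

lemma norm_ip_self: "norm (ip f f) = (nrm f)\<^sup>2"
  by (simp add: nrm_def)

text \<open>The quotient is the coefficient of the orthogonal projection of \<open>f\<close> onto the line through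
  \<open>g\<close>. That the right-hand side is nonnegative is the Cauchy-Schwarz inequality; that it drops below
  \<open>\<parallel>f\<parallel>\<^sup>2\<close> unless \<open>f\<close> is orthogonal to \<open>g\<close> is what makes best approximations orthogonal.\<close>

lemma nrm_residual:
  assumes f: "f \<in> H" and g: "g \<in> H" and "g \<noteq> 0"
  shows "(nrm (f - scl (ip f g / ip g g) g))\<^sup>2 = (nrm f)\<^sup>2 - (norm (ip f g))\<^sup>2 / (nrm g)\<^sup>2"
proof -
  define c where "c = ip f g / ip g g"
  have g0: "nrm g \<noteq> 0" "ip g g \<noteq> 0" using assms nrm_eq_0_iff ip_eq_0_iff by auto
  have "ip (f - scl c g) g = 0"
    using g0 f g by (simp add: ip_diff_left ip_scale_left mem c_def)
  then have "ip (f - scl c g) (f - scl c g) = ip (f - scl c g) f"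
    using f g by (simp add: ip_diff_right ip_scale_right mem)
  also have "\<dots> = ip f f - c * conjugate (ip f g)"
    using f g by (simp add: ip_diff_left ip_scale_left mem ip_sym[of f g])
  also have "\<dots> = of_real ((nrm f)\<^sup>2 - (norm (ip f g))\<^sup>2 / (nrm g)\<^sup>2)"
    using g by (simp add: c_def mult_conj ip_self[OF f] ip_self[OF g] del: of_real_power)
  finally have "(of_real ((nrm (f - scl c g))\<^sup>2) :: 'k) = of_real ((nrm f)\<^sup>2 - (norm (ip f g))\<^sup>2 / (nrm g)\<^sup>2)"
    using f g by (simp add: ip_self mem)
  then show ?thesis unfolding c_def of_real_eq_iff .
qed

lemma Cauchy_Schwarz:
  assumes f: "f \<in> H" and g: "g \<in> H"
  shows "norm (ip f g) \<le> nrm f * nrm g"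
proof (cases "g = 0")
  case True
  then show ?thesis using f by (simp add: ip_zero_right)
next
  case False
  then have "nrm g > 0" using g nrm_eq_0_iff[of g] nrm_nonneg[of g] by linarith
  moreover have "0 \<le> (nrm f)\<^sup>2 - (norm (ip f g))\<^sup>2 / (nrm g)\<^sup>2"
    by (metis nrm_residual[OF f g False] zero_le_power2)
  ultimately have "(norm (ip f g))\<^sup>2 \<le> (nrm f * nrm g)\<^sup>2"
    by (simp add: field_simps power_mult_distrib)
  then show ?thesis by (rule power2_le_imp_le) simp
qed

lemma nrm_triangle:
  assumes f: "f \<in> H" and g: "g \<in> H"
  shows "nrm (f + g) \<le> nrm f + nrm g"
proof -
  have "(nrm (f + g))\<^sup>2 = norm (ip f f + ip f g + (ip g f + ip g g))"
    using f g by (simp add: norm_ip_self[symmetric] ip_add_left ip_add_right mem add_ac)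
  also have "\<dots> \<le> norm (ip f f) + norm (ip f g) + (norm (ip g f) + norm (ip g g))"
    by (intro order_trans[OF norm_triangle_ineq] add_mono order_refl norm_triangle_ineq)
  also have "\<dots> \<le> (nrm f)\<^sup>2 + nrm f * nrm g + (nrm g * nrm f + (nrm g)\<^sup>2)"
    by (intro add_mono Cauchy_Schwarz f g) (auto simp: norm_ip_self)
  also have "\<dots> = (nrm f + nrm g)\<^sup>2" by (simp add: power2_eq_square algebra_simps)
  finally show ?thesis by (rule power2_le_imp_le) simp
qed

lemma nrm_sum:
  "(\<And>x. x \<in> A \<Longrightarrow> F x \<in> H) \<Longrightarrow> nrm (sum F A) \<le> (\<Sum>x\<in>A. nrm (F x))"
proof (induction A rule: infinite_finite_induct)
  case (insert x A)
  then show ?case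
    using nrm_triangle[of "F x" "sum F A"] mem(5)[of A F] by force
qed (use nrm_eq_0_iff[OF mem(1)] in auto)

lemma parallelogram:
  assumes f: "f \<in> H" and g: "g \<in> H"
  shows "(nrm (f + g))\<^sup>2 + (nrm (f - g))\<^sup>2 = 2 * (nrm f)\<^sup>2 + 2 * (nrm g)\<^sup>2"
proof -
  have "ip (f + g) (f + g) + ip (f - g) (f - g) = 2 * ip f f + 2 * ip g g"
    using f g by (simp add: ip_add_left ip_add_right ip_diff_left ip_diff_right mem algebra_simps)
  also have "\<dots> = of_real (2 * (nrm f)\<^sup>2 + 2 * (nrm g)\<^sup>2)"
    using f g by (simp add: ip_self)
  finally have "(of_real ((nrm (f + g))\<^sup>2 + (nrm (f - g))\<^sup>2) :: 'k) = of_real (2 * (nrm f)\<^sup>2 + 2 * (nrm g)\<^sup>2)"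
    using f g by (simp add: ip_self mem)
  then show ?thesis unfolding of_real_eq_iff .
qed

lemma ip_tendsto:
  assumes "\<And>n. X n \<in> H" "x \<in> H" "g \<in> H" "(\<lambda>n. nrm (X n - x)) \<longlonglongrightarrow> 0"
  shows "(\<lambda>n. ip (X n) g) \<longlonglongrightarrow> ip x g"
proof -
  have "(\<lambda>n. ip (X n) g - ip x g) \<longlonglongrightarrow> 0"
  proof (rule Lim_null_comparison)
    show "\<forall>\<^sub>F n in sequentially. norm (ip (X n) g - ip x g) \<le> nrm (X n - x) * nrm g"
      using Cauchy_Schwarz[of "X _ - x" g] assms by (auto simp: ip_diff_left mem)
    show "(\<lambda>n. nrm (X n - x) * nrm g) \<longlonglongrightarrow> 0"
      using assms(4) tendsto_mult_left_zero by blast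
  qed
  then show ?thesis by (simp add: LIM_zero_iff)
qed

text \<open>The partial sums form a Cauchy sequence. Convergence is recorded weakly, through inner products:
  every later use of such a series evaluates it against an element of the space.\<close>

lemma abs_convergent_series:
  assumes X: "\<And>n. X n \<in> H" and s: "summable (\<lambda>n. nrm (X n))"
  obtains x where "x \<in> H" "\<And>g. g \<in> H \<Longrightarrow> (\<lambda>n. ip (X n) g) sums ip x g"
    "nrm x \<le> (\<Sum>n. nrm (X n))"
proof -
  define S where "S n = (\<Sum>k<n. X k)" for n
  have S: "S n \<in> H" for n unfolding S_def by (intro mem X)
  have le: "nrm (S m - S n) \<le> norm (\<Sum>k=n..<m. nrm (X k))" if "n \<le> m" for m n
  proof -
    have "S m - S n = (\<Sum>k=n..<m. X k)"
      unfolding S_def lessThan_atLeast0 by (rule sum_diff_nat_ivl) (use that in auto)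
    then have "nrm (S m - S n) \<le> (\<Sum>k=n..<m. nrm (X k))" using nrm_sum[of "{n..<m}" X] X by simp
    then show ?thesis by simp
  qed
  have "\<exists>N. \<forall>m\<ge>N. \<forall>n\<ge>N. nrm (S m - S n) < \<epsilon>" if \<epsilon>: "\<epsilon> > 0" for \<epsilon>
  proof -
    from s[unfolded summable_Cauchy] \<epsilon> obtain N
      where N: "\<And>m n. m \<ge> N \<Longrightarrow> norm (\<Sum>k=m..<n. nrm (X k)) < \<epsilon>" by blast
    have "nrm (S m - S n) < \<epsilon>" if "m \<ge> N" "n \<ge> N" for m n
    proof (cases "n \<le> m")
      case True
      then show ?thesis using le[OF True] N[OF that(2), of m] by linarith
    next
      case False
      then show ?thesis using le[of m n] N[OF that(1), of n] nrm_minus_commute[OF S S, of m n] by linarith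
    qed
    then show ?thesis by blast
  qed
  then obtain x where x: "x \<in> H" "(\<lambda>n. nrm (S n - x)) \<longlonglongrightarrow> 0"
    using complete[of S] S by blast
  have "(\<lambda>n. ip (X n) g) sums ip x g" if g: "g \<in> H" for g
    using ip_tendsto[OF S x(1) g x(2)] g X unfolding sums_def S_def by (simp add: ip_sum_left)
  moreover have "nrm x \<le> (\<Sum>n. nrm (X n))"
  proof (rule LIMSEQ_le_const)
    show "(\<lambda>n. nrm (S n - x) + (\<Sum>n. nrm (X n))) \<longlonglongrightarrow> (\<Sum>n. nrm (X n))"
      using tendsto_add[OF x(2) tendsto_const[of "\<Sum>n. nrm (X n)"]] by simp
    have "nrm x \<le> nrm (S n - x) + (\<Sum>n. nrm (X n))" for n
    proof -
      have "nrm x \<le> nrm (S n) + nrm (x - S n)"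
        using nrm_triangle[of "S n" "x - S n"] x S by (simp add: mem)
      also have "nrm (S n) \<le> (\<Sum>n. nrm (X n))"
        unfolding S_def by (rule order_trans[OF nrm_sum[OF X] sum_le_suminf[OF s]]) auto
      finally show ?thesis using nrm_minus_commute[OF S x(1)] by simp
    qed
    then show "\<exists>N. \<forall>n\<ge>N. nrm x \<le> nrm (S n - x) + (\<Sum>n. nrm (X n))" by blast
  qed
  ultimately show thesis using that x(1) by blast
qed

text \<open>A minimizing sequence in \<open>S\<close> for the distance to \<open>f\<close> is Cauchy by the parallelogram law, because the
  midpoint of two of its members is no closer to \<open>f\<close> than the infimum. The difference of \<open>f\<close> and
  the limit is orthogonal to \<open>S\<close>, hence zero. The members of this very sequence lie in \<open>S\<close>, so it
  approximates \<open>f\<close>.\<close>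

lemma dense_if_orthogonal_trivial:
  assumes S: "subspace S" "S \<subseteq> H"
    and triv: "\<And>h. h \<in> H \<Longrightarrow> (\<And>s. s \<in> S \<Longrightarrow> ip h s = 0) \<Longrightarrow> h = 0"
    and f: "f \<in> H"
  obtains s where "\<And>n::nat. s n \<in> S" "(\<lambda>n. nrm (s n - f)) \<longlonglongrightarrow> 0"
proof -
  define d where "d = Inf ((\<lambda>h. (nrm (f - h))\<^sup>2) ` S)"
  have SH: "h \<in> H" if "h \<in> S" for h using S that by blast
  have bdd: "bdd_below ((\<lambda>h. (nrm (f - h))\<^sup>2) ` S)" by (rule bdd_belowI[of _ 0]) auto
  have ne: "S \<noteq> {}" using subspace_0[OF S(1)] by blast
  have d_le: "d \<le> (nrm (f - h))\<^sup>2" if "h \<in> S" for h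
    unfolding d_def by (rule cInf_lower[OF _ bdd]) (use that in auto)
  have "\<exists>h\<in>S. (nrm (f - h))\<^sup>2 < d + 1 / (real n + 1)" for n
    using cInf_lessD[of "(\<lambda>h. (nrm (f - h))\<^sup>2) ` S" "d + 1 / (real n + 1)"] ne
    by (auto simp: d_def)
  then obtain s where s: "\<And>n. s n \<in> S" and sd: "\<And>n. (nrm (f - s n))\<^sup>2 < d + 1 / (real n + 1)"
    by metis
  have close: "(nrm (s m - s n))\<^sup>2 \<le> 2 / (real m + 1) + 2 / (real n + 1)" for m n
  proof -
    define u where "u = scl (1/2) (s m + s n)"
    have u: "u \<in> S" unfolding u_def using s S by (simp add: subspace_add subspace_scale)
    have "scl 2 u = s m + s n" by (simp add: u_def)
    then have "(f - s n) + (f - s m) = scl 2 (f - u)"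
      using scale_left_distrib[of 1 1 f] by (simp add: scale_right_diff_distrib algebra_simps)
    moreover have "(f - s n) - (f - s m) = s m - s n" by simp
    ultimately have "(nrm (scl 2 (f - u)))\<^sup>2 + (nrm (s m - s n))\<^sup>2
        = 2 * (nrm (f - s n))\<^sup>2 + 2 * (nrm (f - s m))\<^sup>2"
      using parallelogram[of "f - s n" "f - s m"] f s SH by (simp add: mem)
    then have "4 * (nrm (f - u))\<^sup>2 + (nrm (s m - s n))\<^sup>2
        = 2 * (nrm (f - s n))\<^sup>2 + 2 * (nrm (f - s m))\<^sup>2"
      using f u SH by (simp add: nrm_scale mem power_mult_distrib)
    then show ?thesis using d_le[OF u] sd[of m] sd[of n] by linarith
  qed
  have "\<exists>N. \<forall>m\<ge>N. \<forall>n\<ge>N. nrm (s m - s n) < \<epsilon>" if \<epsilon>: "\<epsilon> > 0" for \<epsilon>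
  proof -
    obtain N where N: "4 / (real N + 1) < \<epsilon>\<^sup>2"
    proof -
      obtain N :: nat where "4 / \<epsilon>\<^sup>2 < real N" using reals_Archimedean2 by blast
      then have "4 / (real N + 1) < \<epsilon>\<^sup>2" using \<epsilon> by (simp add: field_simps) (smt (verit) zero_less_power)
      then show thesis by (rule that)
    qed
    have "nrm (s m - s n) < \<epsilon>" if "m \<ge> N" "n \<ge> N" for m n
    proof -
      have "2 / (real m + 1) \<le> 2 / (real N + 1)" "2 / (real n + 1) \<le> 2 / (real N + 1)"
        using that by (auto intro!: divide_left_mono)
      then have "(nrm (s m - s n))\<^sup>2 < \<epsilon>\<^sup>2" using close[of m n] N by linarith
      then show ?thesis using \<epsilon> by (simp add: power2_less_imp_less)
    qed
    then show ?thesis by blast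
  qed
  then obtain g where g: "g \<in> H" "(\<lambda>n. nrm (s n - g)) \<longlonglongrightarrow> 0"
    using complete[of s] s SH by blast
  \<comment> \<open>The limit \<open>g\<close> need not lie in \<open>S\<close>, but moving it inside \<open>S\<close> still cannot beat the infimum.\<close>
  have le_lim: "d \<le> (nrm (f - g - h))\<^sup>2" if h: "h \<in> S" for h
  proof (rule LIMSEQ_le_const)
    show "(\<lambda>n. (nrm (f - g - h) + nrm (s n - g))\<^sup>2) \<longlonglongrightarrow> (nrm (f - g - h))\<^sup>2"
      using tendsto_power[OF tendsto_add[OF tendsto_const[of "nrm (f - g - h)"] g(2)], of 2] by simp
    have "d \<le> (nrm (f - g - h) + nrm (s n - g))\<^sup>2" for n
    proof -
      have "nrm (f - (s n + h)) \<le> nrm (f - g - h) + nrm (g - s n)"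
        using nrm_triangle[of "f - g - h" "g - s n"] f g s h SH by (simp add: mem algebra_simps)
      then have "(nrm (f - (s n + h)))\<^sup>2 \<le> (nrm (f - g - h) + nrm (s n - g))\<^sup>2"
        using nrm_minus_commute[of g "s n"] g s SH by (intro power_mono) auto
      moreover have "s n + h \<in> S" using s h S(1) by (simp add: subspace_add)
      ultimately show ?thesis using d_le[of "s n + h"] by linarith
    qed
    then show "\<exists>N. \<forall>n\<ge>N. d \<le> (nrm (f - g - h) + nrm (s n - g))\<^sup>2" by blast
  qed
  have "(nrm (f - g))\<^sup>2 \<le> d"
  proof (rule LIMSEQ_le)
    show "(\<lambda>n. (nrm (f - g) - nrm (s n - g))\<^sup>2) \<longlonglongrightarrow> (nrm (f - g))\<^sup>2"
      using tendsto_power[OF tendsto_diff[OF tendsto_const[of "nrm (f - g)"] g(2)], of 2] by simp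
    show "(\<lambda>n. d + 1 / (real n + 1)) \<longlonglongrightarrow> d"
      using tendsto_add[OF tendsto_const[of d] LIMSEQ_inverse_real_of_nat] by (simp add: inverse_eq_divide add.commute)
    have "(nrm (f - g) - nrm (s n - g))\<^sup>2 \<le> d + 1 / (real n + 1)" for n
    proof -
      have "nrm (f - g) \<le> nrm (f - s n) + nrm (s n - g)"
        using nrm_triangle[of "f - s n" "s n - g"] f g s SH by (simp add: mem)
      moreover have "nrm (s n - g) \<le> nrm (f - s n) + nrm (f - g)"
        using nrm_triangle[of "s n - f" "f - g"] f g s SH nrm_minus_commute[of f "s n"] by (simp add: mem)
      ultimately have "\<bar>nrm (f - g) - nrm (s n - g)\<bar> \<le> nrm (f - s n)" by linarith
      then have "(nrm (f - g) - nrm (s n - g))\<^sup>2 \<le> (nrm (f - s n))\<^sup>2"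
        by (metis abs_le_square_iff abs_of_nonneg nrm_nonneg)
      then show ?thesis using sd[of n] by linarith
    qed
    then show "\<exists>N. \<forall>n\<ge>N. (nrm (f - g) - nrm (s n - g))\<^sup>2 \<le> d + 1 / (real n + 1)" by blast
  qed
  have "ip (f - g) h = 0" if h: "h \<in> S" for h
  proof (cases "h = 0")
    case True
    then show ?thesis using f g by (simp add: mem ip_zero_right)
  next
    case False
    have "d \<le> (nrm (f - g - scl (ip (f - g) h / ip h h) h))\<^sup>2"
      using le_lim h S(1) by (simp add: subspace_scale)
    also have "\<dots> = (nrm (f - g))\<^sup>2 - (norm (ip (f - g) h))\<^sup>2 / (nrm h)\<^sup>2"
      using f g SH[OF h] False by (simp add: nrm_residual mem)
    finally have "(norm (ip (f - g) h))\<^sup>2 / (nrm h)\<^sup>2 \<le> 0"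
      using \<open>(nrm (f - g))\<^sup>2 \<le> d\<close> by linarith
    moreover have "nrm h > 0" using False SH[OF h] nrm_eq_0_iff[of h] nrm_nonneg[of h] by linarith
    ultimately show ?thesis by (simp add: divide_le_0_iff)
  qed
  then have "f - g = 0" using triv[of "f - g"] f g by (simp add: mem)
  then have "f = g" by simp
  then show thesis using that s g by blast
qed

end

section \<open>Uniqueness of reproducing kernel Hilbert spaces\<close>

lemma module_pointwise:
  assumes "module scl"
  shows "module (\<lambda>c f z. scl c (f z))"
proof -
  interpret module scl by fact
  show ?thesis by unfold_locales (auto simp: fun_eq_iff scale_right_distrib scale_left_distrib)
qed

text \<open>Nondegeneracy of the pairing on \<open>E\<close> makes the reproducing property determine the values of a
  function, so that elements can be compared by their inner products with the kernel functions.\<close>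

locale rkhs = val: module scl
  for scl :: "'k::real_or_complex \<Rightarrow> 'e::ab_group_add \<Rightarrow> 'e" +
  fixes E :: "'e set" and ipE :: "'e \<Rightarrow> 'e \<Rightarrow> 'k" and L :: "'k \<Rightarrow> 'k \<Rightarrow> 'e \<Rightarrow> 'e"
    and H :: "('k \<Rightarrow> 'e) set" and ip :: "('k \<Rightarrow> 'e) \<Rightarrow> ('k \<Rightarrow> 'e) \<Rightarrow> 'k"
  assumes rkhs: "is_rkhs scl E ipE L H ip"
    and nondegenerate: "\<And>x y. x \<in> E \<Longrightarrow> y \<in> E \<Longrightarrow> (\<And>e. e \<in> E \<Longrightarrow> ipE x e = ipE y e) \<Longrightarrow> x = y"
begin

sublocale hilbert_space "\<lambda>c f z. scl c (f z)" H ip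
  using module_pointwise[OF val.module_axioms] rkhs
  by (simp add: hilbert_space_def hilbert_space_axioms_def is_rkhs_def)

lemma value_mem: "f \<in> H \<Longrightarrow> f z \<in> E"
  using rkhs unfolding is_rkhs_def by blast

lemma kernel_mem: "e \<in> E \<Longrightarrow> (\<lambda>z. L z w e) \<in> H"
  using rkhs unfolding is_rkhs_def by blast

lemma reproducing: "f \<in> H \<Longrightarrow> e \<in> E \<Longrightarrow> ip f (\<lambda>z. L z w e) = ipE (f w) e"
  using rkhs unfolding is_rkhs_def by blast

lemma eq_if_ip_kernel_eq:
  assumes "f \<in> H" "\<And>z. g z \<in> E" "\<And>w e. e \<in> E \<Longrightarrow> ip f (\<lambda>z. L z w e) = ipE (g w) e"
  shows "f = g"
proof
  show "f w = g w" for w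
    by (rule nondegenerate) (use assms value_mem reproducing in auto)
qed

definition kernels :: "('k \<Rightarrow> 'e) set" where
  "kernels = {\<lambda>z. L z w e | w e. e \<in> E}"

lemma span_kernels: "span kernels \<subseteq> H"
  by (rule span_minimal[OF _ subspace_H]) (auto simp: kernels_def kernel_mem)

text \<open>An element orthogonal to all kernel functions has vanishing values.\<close>

lemma span_kernels_dense:
  assumes "f \<in> H"
  obtains s where "\<And>n::nat. s n \<in> span kernels" "(\<lambda>n. nrm (s n - f)) \<longlonglongrightarrow> 0"
proof (rule dense_if_orthogonal_trivial[OF subspace_span span_kernels _ assms])
  fix h assume h: "h \<in> H" and orth: "\<And>s. s \<in> span kernels \<Longrightarrow> ip h s = 0"
  have "ip h (\<lambda>z. L z w e) = ipE (0 w) e" if "e \<in> E" for w e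
  proof -
    have "ip h (\<lambda>z. L z w e) = 0" using that by (intro orth span_base) (auto simp: kernels_def)
    also have "0 = ipE (0 w) e"
      using reproducing[OF mem(1) that] ip_zero_left[OF kernel_mem[OF that]] by simp
    finally show ?thesis .
  qed
  then show "h = 0"
    by (rule eq_if_ip_kernel_eq[OF h value_mem[OF mem(1)]])
qed blast

end

text \<open>Two spaces with the same kernel both contain the span of the kernel functions, and the reproducing
  property forces the same inner product on it. Each space is the closure of that span, and a Cauchy
  sequence in the span has the same pointwise limit in either space.\<close>

locale rkhs_pair = A: rkhs scl E ipE L H1 ip1 + B: rkhs scl E ipE L H2 ip2
  for scl :: "'k::real_or_complex \<Rightarrow> 'e::ab_group_add \<Rightarrow> 'e" and E ipE L H1 ip1 H2 ip2
begin

lemma ip_span_eq: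
  assumes "s \<in> A.span A.kernels" "t \<in> A.span A.kernels"
  shows "ip1 s t = ip2 s t"
proof -
  let ?T = "{t \<in> H1 \<inter> H2. ip1 s t = ip2 s t}"
  have s: "s \<in> H1" "s \<in> H2" using assms A.span_kernels B.span_kernels by auto
  have "A.span A.kernels \<subseteq> ?T"
  proof (rule A.span_minimal)
    show "A.kernels \<subseteq> ?T"
      using s by (auto simp: A.kernels_def A.kernel_mem B.kernel_mem A.reproducing B.reproducing)
    show "A.subspace ?T"
      using s by (intro A.subspaceI)
        (auto simp: A.mem B.mem A.ip_zero_right B.ip_zero_right A.ip_add_right B.ip_add_right
          A.ip_scale_right B.ip_scale_right)
  qed
  then show ?thesis using assms by blast
qed

text \<open>A sequence in the span that approximates \<open>f\<close> in the first space is Cauchy in the second. Its limit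
  there has the same values as \<open>f\<close>, since evaluation is an inner product with a kernel function.\<close>

lemma common_approximation:
  assumes f: "f \<in> H1"
  obtains s where "f \<in> H2" "\<And>n::nat. s n \<in> A.span A.kernels"
    "(\<lambda>n. A.nrm (s n - f)) \<longlonglongrightarrow> 0" "(\<lambda>n. B.nrm (s n - f)) \<longlonglongrightarrow> 0"
proof -
  obtain s where s: "\<And>n::nat. s n \<in> A.span A.kernels" and sf: "(\<lambda>n. A.nrm (s n - f)) \<longlonglongrightarrow> 0"
    using A.span_kernels_dense[OF f] by metis
  have sH: "s n \<in> H1" "s n \<in> H2" for n using s A.span_kernels B.span_kernels by auto
  have nrm_eq: "B.nrm (s m - s n) = A.nrm (s m - s n)" for m n
    using s by (simp add: A.nrm_def B.nrm_def ip_span_eq A.span_diff)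
  have "\<exists>N. \<forall>m\<ge>N. \<forall>n\<ge>N. B.nrm (s m - s n) < \<epsilon>" if "\<epsilon> > 0" for \<epsilon>
  proof -
    have "\<forall>\<^sub>F n in sequentially. A.nrm (s n - f) < \<epsilon> / 2"
      using order_tendstoD(2)[OF sf, of "\<epsilon> / 2"] that by simp
    then obtain N where N: "\<And>n. n \<ge> N \<Longrightarrow> A.nrm (s n - f) < \<epsilon> / 2"
      by (auto simp: eventually_sequentially)
    have "B.nrm (s m - s n) < \<epsilon>" if "m \<ge> N" "n \<ge> N" for m n
    proof -
      have "A.nrm (s m - s n) \<le> A.nrm (s m - f) + A.nrm (f - s n)"
        using A.nrm_triangle[of "s m - f" "f - s n"] sH f by (simp add: A.mem)
      then show ?thesis
        using N[OF that(1)] N[OF that(2)] A.nrm_minus_commute[OF f sH(1), of n] nrm_eq[of m n] by linarith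
    qed
    then show ?thesis by blast
  qed
  then obtain g where g: "g \<in> H2" and sg: "(\<lambda>n. B.nrm (s n - g)) \<longlonglongrightarrow> 0"
    using B.complete[of s] sH by blast
  have "f = g"
  proof (rule A.eq_if_ip_kernel_eq[OF f B.value_mem[OF g]])
    fix w e assume e: "e \<in> E"
    have "(\<lambda>n. ip1 (s n) (\<lambda>z. L z w e)) \<longlonglongrightarrow> ip1 f (\<lambda>z. L z w e)"
      using A.ip_tendsto[OF sH(1) f A.kernel_mem[OF e] sf] .
    moreover have "(\<lambda>n. ip2 (s n) (\<lambda>z. L z w e)) \<longlonglongrightarrow> ip2 g (\<lambda>z. L z w e)"
      using B.ip_tendsto[OF sH(2) g B.kernel_mem[OF e] sg] .
    ultimately show "ip1 f (\<lambda>z. L z w e) = ipE (g w) e"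
      using e g sH by (simp add: A.reproducing B.reproducing LIMSEQ_unique)
  qed
  with g s sf sg that show thesis by blast
qed

lemma ip_eq:
  assumes f: "f \<in> H1" and g: "g \<in> H1"
  shows "ip1 f g = ip2 f g"
proof -
  obtain s where f2: "f \<in> H2" and s: "\<And>n::nat. s n \<in> A.span A.kernels"
    and sf: "(\<lambda>n. A.nrm (s n - f)) \<longlonglongrightarrow> 0" "(\<lambda>n. B.nrm (s n - f)) \<longlonglongrightarrow> 0"
    using common_approximation[OF f] by metis
  obtain t where g2: "g \<in> H2" and t: "\<And>n::nat. t n \<in> A.span A.kernels"
    and tg: "(\<lambda>n. A.nrm (t n - g)) \<longlonglongrightarrow> 0" "(\<lambda>n. B.nrm (t n - g)) \<longlonglongrightarrow> 0"
    using common_approximation[OF g] by metis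
  have sH: "s n \<in> H1" "s n \<in> H2" and tH: "t n \<in> H1" "t n \<in> H2" for n
    using s t A.span_kernels B.span_kernels by auto
  have ft: "ip1 f (t m) = ip2 f (t m)" for m
    using A.ip_tendsto[OF sH(1) f tH(1) sf(1), of m] B.ip_tendsto[OF sH(2) f2 tH(2) sf(2), of m]
    by (simp add: ip_span_eq s t LIMSEQ_unique)
  have "ip1 (t m) f = ip2 (t m) f" for m
    using ft[of m] A.ip_sym[OF f tH(1), of m] B.ip_sym[OF f2 tH(2), of m] by simp
  then have "ip1 g f = ip2 g f"
    using A.ip_tendsto[OF tH(1) g f tg(1)] B.ip_tendsto[OF tH(2) g2 f2 tg(2)]
    by (simp add: LIMSEQ_unique)
  then show ?thesis using A.ip_sym[OF g f] B.ip_sym[OF g2 f2] by simp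
qed

lemma subset: "H1 \<subseteq> H2"
proof
  show "f \<in> H2" if "f \<in> H1" for f
    using common_approximation[OF that] by metis
qed

end

lemma rkhs_unique:
  assumes "rkhs scl E ipE L H1 ip1" "rkhs scl E ipE L H2 ip2"
  shows "H1 = H2" "\<And>f g. f \<in> H1 \<Longrightarrow> g \<in> H1 \<Longrightarrow> ip1 f g = ip2 f g"
proof -
  interpret P: rkhs_pair scl E ipE L H1 ip1 H2 ip2 by (intro rkhs_pair.intro assms)
  interpret Q: rkhs_pair scl E ipE L H2 ip2 H1 ip1 by (intro rkhs_pair.intro assms)
  show "H1 = H2" using P.subset Q.subset by (rule equalityI)
  show "ip1 f g = ip2 f g" if "f \<in> H1" "g \<in> H1" for f g by (rule P.ip_eq[OF that])
qed

section \<open>Double power series\<close>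

text \<open>In finite dimension unordered summability is absolute, as one sees coordinate by coordinate. This
  permits to rearrange, shift and dominate the double power series of the kernel.\<close>

lemma has_sum_imp_abs_summable:
  fixes f :: "'a \<Rightarrow> 'b::euclidean_space"
  assumes "(f has_sum s) A"
  shows "(\<lambda>x. norm (f x)) summable_on A"
proof (rule Infinite_Sum.abs_summable_on_comparison_test')
  have "(\<lambda>x. \<bar>f x \<bullet> b\<bar>) summable_on A" for b
    using has_sum_bounded_linear[OF bounded_linear_inner_left assms, of b]
      summable_on_iff_abs_summable_on_real[of "\<lambda>x. f x \<bullet> b" A]
    by (auto simp: summable_on_def)
  then have "(\<lambda>x. \<Sum>b\<in>B. \<bar>f x \<bullet> b\<bar>) summable_on A" for B
    by (induction B rule: infinite_finite_induct) (auto intro: summable_on_add)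
  then show "(\<lambda>x. \<Sum>b\<in>Basis. \<bar>f x \<bullet> b\<bar>) summable_on A" .
qed (rule norm_le_l1)

lemma has_sum_double_imp_sums:
  fixes c :: "nat \<Rightarrow> nat \<Rightarrow> 'b::banach"
  assumes "((\<lambda>(n, m). c n m) has_sum s) UNIV"
  shows "c n sums (\<Sum>m. c n m)" "(\<lambda>n. \<Sum>m. c n m) sums s"
proof -
  have row: "(c n has_sum (\<Sum>m. c n m)) UNIV" for n
  proof -
    have "c n summable_on UNIV"
    proof -
      have "(\<lambda>(n, m). c n m) summable_on Pair n ` UNIV"
        by (rule summable_on_subset_banach[of _ UNIV]) (use assms in \<open>auto simp: summable_on_def\<close>)
      then show ?thesis by (subst (asm) summable_on_reindex) (auto simp: inj_on_def o_def)
    qed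
    then show ?thesis
      using has_sum_imp_sums has_sum_infsum sums_unique by metis
  qed
  then show "c n sums (\<Sum>m. c n m)" by (rule has_sum_imp_sums)
  have "((\<lambda>n. \<Sum>m. c n m) has_sum s) UNIV"
    by (rule has_sum_SigmaD[where f = "\<lambda>(n, m). c n m" and A = UNIV and B = "\<lambda>_. UNIV"]) (use assms row in auto)
  then show "(\<lambda>n. \<Sum>m. c n m) sums s" by (rule has_sum_imp_sums)
qed

lemma has_sum_double_swap:
  "((\<lambda>(n, m). c n m) has_sum s) UNIV \<Longrightarrow> ((\<lambda>(n, m). c m n) has_sum s) UNIV"
  using has_sum_swap[where f = "\<lambda>(n, m). c n m" and A = UNIV and B = UNIV] by simp

text \<open>Comparison with a geometric series, by using the bound for a radius larger than \<open>r\<close>.\<close>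

lemma summable_if_bounded_weights:
  fixes u :: "nat \<Rightarrow> real"
  assumes "\<And>n. u n \<ge> 0" "\<And>R. R > 0 \<Longrightarrow> \<exists>B. \<forall>n. u n * R ^ n \<le> B" "r \<ge> 0"
  shows "summable (\<lambda>n. u n * r ^ n)"
proof -
  define R where "R = 2 * r + 1"
  have R: "R > 0" "r / R \<ge> 0" "norm (r / R) < 1" using assms(3) by (auto simp: R_def field_simps)
  obtain B where B: "\<And>n. u n * R ^ n \<le> B" using assms(2) R by blast
  show ?thesis
  proof (rule summable_comparison_test)
    show "summable (\<lambda>n. B * (r / R) ^ n)"
      using R by (intro summable_mult summable_geometric) auto
    have "u n * r ^ n \<le> B * (r / R) ^ n" for n
    proof -
      have "u n * r ^ n = (u n * R ^ n) * (r / R) ^ n" using R by (simp add: power_divide)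
      also have "\<dots> \<le> B * (r / R) ^ n" using B R by (intro mult_right_mono) auto
      finally show ?thesis .
    qed
    then show "\<exists>N. \<forall>n\<ge>N. norm (u n * r ^ n) \<le> B * (r / R) ^ n"
      using assms by auto
  qed
qed

section \<open>Vectors with an entire Gram kernel\<close>

context hilbert_space
begin

text \<open>If the Gram kernel of a family \<open>k w\<close> is an everywhere convergent double power series, then the family
  itself is an everywhere convergent power series \<open>k w = (\<Sum>m. conjugate w ^ m \<cdot> \<phi> m)\<close> in the Hilbert
  space. The proof is uniform in the two scalar fields: instead of a Cauchy integral, which would
  be confined to the complex numbers, it extracts the coefficients along real \<open>t \<rightarrow> 0\<close>.

  If \<open>\<phi> l\<close> is known for \<open>l < m\<close>, the remainder quotient
  \<open>D t = t ^ (-m) \<cdot> (k t - (\<Sum>l<m. t ^ l \<cdot> \<phi> l))\<close> should converge to \<open>\<phi> m\<close>. By the formula for the Gram kernel,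
  \<open>ip (D t) (D s) = (\<Sum>n j. a (n + m) (j + m) * s ^ n * t ^ j)\<close>, which tends to \<open>a m m\<close> as \<open>s\<close> and \<open>t\<close>
  tend to zero; so \<open>D t\<close> is Cauchy, and \<open>\<phi> m\<close> exists. The induction carries along that
  \<open>ip f (\<phi> m)\<close> is the \<open>m\<close>-th coefficient of \<open>ip f (k x)\<close> whenever the latter is a power series.

  Then \<open>ip (\<phi> m) (\<phi> l) = a l m\<close>, and the convergence of the diagonal of the double series gives the decay
  of the norms of \<open>\<phi> m\<close>. The sum of the series \<open>\<Sum>m. conjugate w ^ m \<cdot> \<phi> m\<close> differs from \<open>k w\<close> by an element
  that is orthogonal to every \<open>\<phi> l\<close> and to \<open>k w\<close>, hence to itself.\<close>

lemma gram_power_series_hermitian: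
  assumes k: "\<And>w. k w \<in> H"
    and gram: "\<And>z w. ((\<lambda>(n, m). a n m * z ^ n * conjugate w ^ m) has_sum ip (k w) (k z)) UNIV"
    and herm: "\<And>n m. conjugate (a m n) = a n m"
  obtains \<phi> where "\<And>m::nat. \<phi> m \<in> H" "\<And>R. R > 0 \<Longrightarrow> \<exists>B. \<forall>m. nrm (\<phi> m) * R ^ m \<le> B"
    "\<And>g w. g \<in> H \<Longrightarrow> (\<lambda>m. ip g (\<phi> m) * w ^ m) sums ip g (k w)"
proof -
  have abs_summable: "(\<lambda>(n, m). norm (a n m) * R ^ n * R ^ m) summable_on UNIV" if "R \<ge> 0" for R
    using has_sum_imp_abs_summable[OF gram[of "of_real R" "of_real R"]] that
    by (simp add: case_prod_unfold norm_mult norm_power conj_of_real)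
  have shifted: "((\<lambda>(n, m). a (n + i) (m + j) * x ^ n * y ^ m) has_sum
      (\<Sum>\<^sub>\<infinity>(n, m). a (n + i) (m + j) * x ^ n * y ^ m)) UNIV" for i j x y
  proof -
    define R where "R = max 1 (max (norm x) (norm y))"
    have R: "R \<ge> 1" "R \<ge> norm x" "R \<ge> norm y" by (auto simp: R_def)
    have "(\<lambda>(n, m). norm (a n m) * R ^ n * R ^ m) summable_on (\<lambda>(n, m). (n + i, m + j)) ` UNIV"
      by (rule summable_on_subset_banach[OF abs_summable]) (use R in auto)
    then have s: "(\<lambda>(n, m). norm (a (n + i) (m + j)) * R ^ (n + i) * R ^ (m + j)) summable_on UNIV"
      by (subst (asm) summable_on_reindex) (auto simp: inj_on_def o_def case_prod_unfold)
    have "(\<lambda>p. norm ((\<lambda>(n, m). a (n + i) (m + j) * x ^ n * y ^ m) p)) summable_on UNIV"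
    proof (rule Infinite_Sum.abs_summable_on_comparison_test'[OF s], clarify)
      fix n m
      have "norm x ^ n \<le> R ^ (n + i)"
        using R by (meson order_trans power_mono norm_ge_zero power_increasing le_add1)
      moreover have "norm y ^ m \<le> R ^ (m + j)"
        using R by (meson order_trans power_mono norm_ge_zero power_increasing le_add1)
      ultimately show "norm (a (n + i) (m + j) * x ^ n * y ^ m)
          \<le> norm (a (n + i) (m + j)) * R ^ (n + i) * R ^ (m + j)"
        using R by (auto simp: norm_mult norm_power intro!: mult_mono)
    qed
    from has_sum_infsum[OF abs_summable_summable[OF this]] show ?thesis .
  qed
  \<comment> \<open>\<open>row j x n\<close> sums the \<open>n\<close>-th row of the coefficient matrix, with its first \<open>j\<close> columns removed.\<close>
  define row where "row j x n = (\<Sum>m. a n (m + j) * x ^ m)" for j x n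
  have row: "(\<lambda>m. a n (m + j) * x ^ m) sums row j x n" for n j x
    using has_sum_double_imp_sums(1)[OF shifted[of 0 j 1 x], of n] by (simp add: row_def)
  have double: "(\<lambda>n. row j y (n + i) * x ^ n) sums (\<Sum>\<^sub>\<infinity>(n, m). a (n + i) (m + j) * x ^ n * y ^ m)"
    for i j x y
  proof -
    have "(\<Sum>m. a (n + i) (m + j) * x ^ n * y ^ m) = row j y (n + i) * x ^ n" for n
      using sums_mult2[OF row[of "n + i" j y], of "x ^ n"] by (simp add: sums_iff mult_ac)
    then show ?thesis using has_sum_double_imp_sums(2)[OF shifted[of i j x y]] by simp
  qed
  have row0: "(\<lambda>n. row 0 (conjugate w) n * z ^ n) sums ip (k w) (k z)" for w z
    using double[of 0 "conjugate w" 0 z] infsumI[OF gram[of z w]] by simp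
  have conj_row: "(\<lambda>n. a n m * x ^ n) sums conjugate (row 0 (conjugate x) m)" for m x
    using conj_sums[OF row[of m 0 "conjugate x"]] by (simp add: conj_simps herm)
  define P where "P m \<phi> \<longleftrightarrow> \<phi> \<in> H \<and>
    (\<forall>f\<in>H. \<forall>c. (\<forall>x. (\<lambda>n. c n * x ^ n) sums ip f (k x)) \<longrightarrow> ip f \<phi> = c m)" for m \<phi>
  have PD: "ip f \<phi> = c m" if "P m \<phi>" "f \<in> H" "\<And>x. (\<lambda>n. c n * x ^ n) sums ip f (k x)" for m \<phi> f c
    using that unfolding P_def by blast
  have "\<exists>\<phi>. P m \<phi>" for m
  proof (induction m rule: less_induct)
    case (less m)
    then obtain \<phi> where \<phi>: "\<And>l. l < m \<Longrightarrow> P l (\<phi> l)" by metis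
    then have \<phi>H: "l < m \<Longrightarrow> \<phi> l \<in> H" for l unfolding P_def by blast
    define D :: "real \<Rightarrow> 'v" where "D t = scl (inverse (of_real t ^ m))
      (k (of_real t) - (\<Sum>l<m. scl (of_real t ^ l) (\<phi> l)))" for t
    have D: "D t \<in> H" for t unfolding D_def by (intro mem k \<phi>H) auto
    have ipD: "(\<lambda>n. c (n + m) * of_real t ^ n) sums ip f (D t)"
      if f: "f \<in> H" and c: "\<And>x. (\<lambda>n. c n * x ^ n) sums ip f (k x)" and t: "t \<noteq> 0" for f c t
    proof -
      let ?t = "of_real t :: 'k"
      have "(\<lambda>n. c (n + m) * ?t ^ (n + m)) sums (ip f (k ?t) - (\<Sum>l<m. c l * ?t ^ l))"
        by (rule sums_split_initial_segment[OF c])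
      from sums_mult[OF this, of "inverse (?t ^ m)"]
      have "(\<lambda>n. c (n + m) * ?t ^ n) sums (inverse (?t ^ m) * (ip f (k ?t) - (\<Sum>l<m. c l * ?t ^ l)))"
        using t by (simp add: power_add field_simps)
      also have "inverse (?t ^ m) * (ip f (k ?t) - (\<Sum>l<m. c l * ?t ^ l)) = ip f (D t)"
      proof -
        have "ip f (D t) = conjugate (inverse (?t ^ m)) *
            (ip f (k ?t) - (\<Sum>l<m. conjugate (?t ^ l) * ip f (\<phi> l)))"
        proof -
          have "(\<Sum>l<m. scl (?t ^ l) (\<phi> l)) \<in> H" by (intro mem \<phi>H) auto
          moreover have "ip f (\<Sum>l<m. scl (?t ^ l) (\<phi> l)) = (\<Sum>l<m. conjugate (?t ^ l) * ip f (\<phi> l))"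
            using f \<phi>H by (subst ip_sum_right) (auto simp: ip_scale_right mem intro!: sum.cong)
          ultimately show ?thesis unfolding D_def using f k
            by (simp add: ip_scale_right ip_diff_right mem(4))
        qed
        also have "conjugate (inverse (?t ^ m)) = inverse (?t ^ m)"
          by (metis conj_of_real of_real_inverse of_real_power)
        also have "(\<Sum>l<m. conjugate (?t ^ l) * ip f (\<phi> l)) = (\<Sum>l<m. c l * ?t ^ l)"
          using PD[OF \<phi> f c] by (intro sum.cong) (auto simp: conj_simps mult.commute)
        finally show ?thesis by simp
      qed
      finally show ?thesis .
    qed
    \<comment> \<open>The two orders of summation of the double series expand \<open>ip (D t) (k x)\<close> in \<open>x\<close> and in \<open>t\<close>.\<close>
    have D_coeff: "(\<lambda>n. row m (of_real t) n * x ^ n) sums ip (D t) (k x)" if t: "t \<noteq> 0" for t x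
    proof -
      let ?t = "of_real t :: 'k"
      define s where "s = (\<Sum>\<^sub>\<infinity>(n, j). a n (j + m) * x ^ n * ?t ^ j)"
      have hs: "((\<lambda>(n, j). a n (j + m) * x ^ n * ?t ^ j) has_sum s) UNIV"
        using shifted[of 0 m x ?t] by (simp add: s_def)
      have "(\<lambda>n. row m ?t n * x ^ n) sums s"
        using double[of m ?t 0 x] by (simp add: s_def)
      moreover have "(\<Sum>n. a n (j + m) * x ^ n * ?t ^ j) = conjugate (row 0 (conjugate x) (j + m)) * ?t ^ j" for j
        using sums_mult2[OF conj_row[of "j + m" x], of "?t ^ j"] by (simp add: sums_iff)
      then have "(\<lambda>j. conjugate (row 0 (conjugate x) (j + m)) * ?t ^ j) sums s"
        using has_sum_double_imp_sums(2)[OF has_sum_double_swap[OF hs]] by simp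
      moreover have "(\<lambda>j. conjugate (row 0 (conjugate x) (j + m)) * ?t ^ j) sums ip (D t) (k x)"
        using conj_sums[OF ipD[OF k row0 t, of x]]
        by (simp add: conj_simps ip_sym[OF k D, symmetric])
      ultimately show ?thesis by (metis sums_unique2)
    qed
    define C where "C = (\<Sum>\<^sub>\<infinity>(n, j). norm (a (n + m) (j + m)))"
    have C: "((\<lambda>(n, j). norm (a (n + m) (j + m))) has_sum C) UNIV"
      using has_sum_imp_abs_summable[OF shifted[of m m 1 1]] by (simp add: C_def case_prod_unfold)
    have near: "norm (ip (D t) (D s) - a m m) \<le> max t s * C" if t: "0 < t" "t \<le> 1" and s: "0 < s" "s \<le> 1" for t s
    proof -
      let ?g = "\<lambda>(n, j). a (n + m) (j + m) * of_real s ^ n * of_real t ^ j :: 'k"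
      have "(\<lambda>n. row m (of_real t) (n + m) * of_real s ^ n) sums ip (D t) (D s)"
        by (rule ipD[OF D D_coeff]) (use s t in auto)
      then have "ip (D t) (D s) = (\<Sum>\<^sub>\<infinity>p. ?g p)"
        using sums_unique2[OF _ double[of m "of_real t" m "of_real s"]] by blast
      then have "(?g has_sum ip (D t) (D s)) UNIV"
        using shifted[of m m "of_real s" "of_real t"] by simp
      moreover have "((\<lambda>p. if p = (0, 0) then a m m else 0) has_sum a m m) UNIV"
        by (rule has_sum_finite_neutralI[of "{(0, 0)}"]) auto
      ultimately have "((\<lambda>p. ?g p + - (if p = (0, 0) then a m m else 0)) has_sum (ip (D t) (D s) + - a m m)) UNIV"
        by (intro has_sum_add has_sum_uminusI)
      moreover have "((\<lambda>p. max t s * (\<lambda>(n, j). norm (a (n + m) (j + m))) p) has_sum max t s * C) UNIV"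
        by (rule has_sum_cmult_right[OF C])
      ultimately have "norm (ip (D t) (D s) + - a m m) \<le> max t s * C"
      proof (rule norm_infsum_le, clarify)
        fix n j :: nat
        show "norm (a (n + m) (j + m) * of_real s ^ n * of_real t ^ j
            + - (if (n, j) = (0, 0) then a m m else 0)) \<le> max t s * norm (a (n + m) (j + m))"
        proof (cases "n = 0 \<and> j = 0")
          case True
          then show ?thesis using t by (simp add: max_def)
        next
          case False
          have "s ^ n * t ^ j \<le> max t s"
          proof (cases "n = 0")
            case True
            then obtain j' where "j = Suc j'" using False by (cases j) auto
            then show ?thesis using True t mult_left_le[of "t ^ j'" t] by (simp add: power_le_one le_max_iff_disj)
          next
            case n: False
            then obtain n' where "n = Suc n'" by (cases n) auto
            moreover have "s ^ n' * t ^ j \<le> 1" using s t by (intro mult_le_one power_le_one) auto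
            ultimately show ?thesis using s mult_left_le[of "s ^ n' * t ^ j" s]
              by (simp add: mult.assoc le_max_iff_disj)
          qed
          then have "norm (a (n + m) (j + m)) * (s ^ n * t ^ j) \<le> norm (a (n + m) (j + m)) * max t s"
            by (rule mult_left_mono) simp
          then show ?thesis using False s t by (auto simp: norm_mult norm_power mult_ac)
        qed
      qed
      then show ?thesis by simp
    qed
    \<comment> \<open>Any null sequence of positive reals not exceeding 1 would do.\<close>
    define \<tau> where "\<tau> i = 1 / (real i + 1)" for i
    have \<tau>: "0 < \<tau> i" "\<tau> i \<le> 1" for i by (auto simp: \<tau>_def)
    have \<tau>0: "\<tau> \<longlonglongrightarrow> 0"
      using LIMSEQ_inverse_real_of_nat by (simp add: \<tau>_def[abs_def] inverse_eq_divide add.commute)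
    have C0: "C \<ge> 0" using has_sum_nonneg[OF C] by auto
    \<comment> \<open>The squared norm is a signed sum of four inner products close to \<open>a m m\<close>, which cancels.\<close>
    have dist: "(nrm (D (\<tau> i) - D (\<tau> j)))\<^sup>2 \<le> 4 * (max (\<tau> i) (\<tau> j) * C)" for i j
    proof -
      let ?e = "\<lambda>i j. ip (D (\<tau> i)) (D (\<tau> j)) - a m m"
      have "(nrm (D (\<tau> i) - D (\<tau> j)))\<^sup>2 = norm ((?e i i - ?e j i) - (?e i j - ?e j j))"
        using D by (simp add: norm_ip_self[symmetric] ip_diff_left ip_diff_right mem)
      also have "\<dots> \<le> (norm (?e i i) + norm (?e j i)) + (norm (?e i j) + norm (?e j j))"
        by (intro order_trans[OF norm_triangle_ineq4] add_mono norm_triangle_ineq4)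
      also have "\<dots> \<le> 4 * (max (\<tau> i) (\<tau> j) * C)"
      proof -
        have "norm (?e p q) \<le> max (\<tau> i) (\<tau> j) * C" if "p \<in> {i, j}" "q \<in> {i, j}" for p q
          using that by (intro order_trans[OF near[OF \<tau> \<tau>]] mult_right_mono C0) auto
        from this[of i i] this[of i j] this[of j i] this[of j j] show ?thesis by simp
      qed
      finally show ?thesis .
    qed
    have "\<exists>N. \<forall>i\<ge>N. \<forall>j\<ge>N. nrm (D (\<tau> i) - D (\<tau> j)) < \<epsilon>" if \<epsilon>: "\<epsilon> > 0" for \<epsilon>
    proof -
      have "(\<lambda>i. 4 * (\<tau> i * C)) \<longlonglongrightarrow> 4 * (0 * C)" by (intro tendsto_intros \<tau>0)
      then have "\<forall>\<^sub>F i in sequentially. 4 * (\<tau> i * C) < \<epsilon>\<^sup>2"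
        using order_tendstoD(2)[of "\<lambda>i. 4 * (\<tau> i * C)" 0 sequentially "\<epsilon>\<^sup>2"] \<epsilon> by simp
      then obtain N where N: "\<And>i. i \<ge> N \<Longrightarrow> 4 * (\<tau> i * C) < \<epsilon>\<^sup>2"
        by (auto simp: eventually_sequentially)
      have "nrm (D (\<tau> i) - D (\<tau> j)) < \<epsilon>" if "i \<ge> N" "j \<ge> N" for i j
      proof -
        have "(nrm (D (\<tau> i) - D (\<tau> j)))\<^sup>2 < \<epsilon>\<^sup>2"
          using dist[of i j] N[OF that(1)] N[OF that(2)] by (auto simp: max_def split: if_splits)
        then show ?thesis using \<epsilon> by (simp add: power2_less_imp_less)
      qed
      then show ?thesis by blast
    qed
    then obtain \<psi> where \<psi>: "\<psi> \<in> H" "(\<lambda>i. nrm (D (\<tau> i) - \<psi>)) \<longlonglongrightarrow> 0"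
      using complete[of "\<lambda>i. D (\<tau> i)"] D by blast
    have "ip f \<psi> = c m" if f: "f \<in> H" and c: "\<And>x. (\<lambda>n. c n * x ^ n) sums ip f (k x)" for f c
    proof -
      have sm: "summable (\<lambda>n. c (n + m) * x ^ n)" for x
      proof (cases "x = 0")
        case False
        have "summable (\<lambda>n. c (n + m) * x ^ (n + m))"
          using sums_summable[OF sums_split_initial_segment[OF c, of m x]] .
        from summable_mult2[OF this, of "inverse (x ^ m)"] show ?thesis
          using False by (simp add: power_add field_simps)
      qed simp
      define F where "F x = (\<Sum>n. c (n + m) * x ^ n)" for x
      have "(\<lambda>n. c (n + m) * x ^ n) sums F x" for x
        using sm[of x] by (simp add: F_def summable_sums)
      then have "(F \<longlongrightarrow> c m) (at 0)"
        using powser_limit_0[of 1 "\<lambda>n. c (n + m)" F] by simp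
      moreover have "filterlim (\<lambda>i. of_real (\<tau> i) :: 'k) (at 0) sequentially"
      proof -
        have "(\<lambda>i. of_real (\<tau> i) :: 'k) \<longlonglongrightarrow> 0"
          using tendsto_of_real[OF \<tau>0, where 'a='k] by simp
        moreover have "of_real (\<tau> i) \<noteq> (0 :: 'k)" for i using \<tau>(1)[of i] by simp
        ultimately show ?thesis by (simp add: filterlim_at)
      qed
      ultimately have "(\<lambda>i. F (of_real (\<tau> i))) \<longlonglongrightarrow> c m"
        by (rule filterlim_compose)
      moreover have "F (of_real (\<tau> i)) = ip f (D (\<tau> i))" for i
        using ipD[OF f c, of "\<tau> i"] \<tau>(1)[of i] by (simp add: F_def sums_iff)
      ultimately have "(\<lambda>i. ip f (D (\<tau> i))) \<longlonglongrightarrow> c m" by simp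
      moreover have "(\<lambda>i. conjugate (ip (D (\<tau> i)) f)) \<longlonglongrightarrow> conjugate (ip \<psi> f)"
        by (intro bounded_linear.tendsto[OF bounded_linear_conjugate] ip_tendsto[OF D \<psi>(1) f \<psi>(2)])
      ultimately show ?thesis
        by (simp add: ip_sym[OF D f, symmetric] ip_sym[OF \<psi>(1) f, symmetric] LIMSEQ_unique)
    qed
    then show ?case using \<psi>(1) unfolding P_def by blast
  qed
  then obtain \<phi> where \<phi>: "\<And>m. P m (\<phi> m)" by metis
  have \<phi>H: "\<phi> m \<in> H" for m using \<phi> unfolding P_def by blast
  have ip_k: "ip (k x) (\<phi> m) = row 0 (conjugate x) m" for x m
    by (rule PD[OF \<phi> k row0])
  have ip_\<phi>: "ip (\<phi> m) (\<phi> l) = a l m" for m l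
    by (rule PD[OF \<phi> \<phi>H]) (use conj_row ip_sym[OF k \<phi>H] ip_k in auto)
  have bound: "\<exists>B. \<forall>m. nrm (\<phi> m) * R ^ m \<le> B" if R: "R > 0" for R
  proof -
    define C where "C = (\<Sum>\<^sub>\<infinity>(n, m). norm (a n m) * R ^ n * R ^ m)"
    have "nrm (\<phi> m) * R ^ m \<le> sqrt C" for m
    proof (rule real_le_rsqrt)
      have "(\<lambda>(n, m). norm (a n m) * R ^ n * R ^ m) (m, m) \<le> C"
        using finite_sum_le_infsum[OF abs_summable, of R "{(m, m)}"] R by (auto simp: C_def)
      then show "(nrm (\<phi> m) * R ^ m)\<^sup>2 \<le> C"
        using norm_ip_self[of "\<phi> m"]
        by (simp add: power_mult_distrib ip_\<phi> power2_eq_square[of "R ^ m"] mult.assoc)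
    qed
    then show ?thesis by blast
  qed
  have "(\<lambda>m. ip g (\<phi> m) * w ^ m) sums ip g (k w)" if g: "g \<in> H" for g w
  proof -
    have "summable (\<lambda>m. nrm (scl (conjugate w ^ m) (\<phi> m)))"
      using summable_if_bounded_weights[OF _ bound, where r = "norm w"] \<phi>H
      by (simp add: nrm_scale norm_power mult.commute)
    then obtain x where x: "x \<in> H"
      and xs: "\<And>g. g \<in> H \<Longrightarrow> (\<lambda>m. ip (scl (conjugate w ^ m) (\<phi> m)) g) sums ip x g"
      using abs_convergent_series[of "\<lambda>m. scl (conjugate w ^ m) (\<phi> m)"] mem(3)[OF \<phi>H] by metis
    have xs: "(\<lambda>m. conjugate w ^ m * ip (\<phi> m) g) sums ip x g" if "g \<in> H" for g
      using xs[OF that] that \<phi>H by (simp add: ip_scale_left)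
    define d where "d = k w - x"
    have d: "d \<in> H" using k x by (simp add: d_def mem)
    have "ip x (k w) = ip (k w) (k w)"
    proof -
      have "(\<lambda>m. conjugate w ^ m * ip (\<phi> m) (k w)) sums ip (k w) (k w)"
        using conj_sums[OF row0[of w w]]
        by (simp add: conj_simps ip_sym[OF k k, symmetric] ip_sym[OF k \<phi>H] ip_k mult.commute)
      then show ?thesis using xs[OF k] sums_unique2 by blast
    qed
    then have dk: "ip (k w) d = 0"
      using k x by (simp add: d_def ip_diff_right ip_sym[OF x k] ip_sym[OF k k, symmetric])
    have "ip x (\<phi> l) = ip (k w) (\<phi> l)" for l
      using xs[OF \<phi>H, of l] row[of l 0 "conjugate w"]
      by (simp add: ip_\<phi> ip_k mult.commute sums_unique2)
    then have "ip d (\<phi> l) = 0" for l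
      using k x \<phi>H by (simp add: d_def ip_diff_left)
    then have "ip (\<phi> l) d = 0" for l using ip_sym[OF d \<phi>H, of l] by simp
    then have "ip x d = 0" using xs[OF d] sums_unique2[OF sums_zero] by simp
    then have "ip d d = 0" using dk k x d by (simp add: d_def ip_diff_left mem)
    then have "x = k w" using ip_eq_0_iff[OF d] by (simp add: d_def)
    then show ?thesis
      using conj_sums[OF xs[OF g]]
      by (simp add: conj_simps ip_sym[OF \<phi>H g, symmetric] ip_sym[OF k g, symmetric] mult.commute)
  qed
  then show thesis using that \<phi>H bound by blast
qed

text \<open>A Gram kernel is Hermitian, so the coefficient matrix may be replaced by its Hermitian part without
  changing the sum of the series. This spares the uniqueness of double power series.\<close>

lemma gram_power_series:
  assumes k: "\<And>w. k w \<in> H"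
    and gram: "\<And>z w. ((\<lambda>(n, m). a n m * z ^ n * conjugate w ^ m) has_sum ip (k w) (k z)) UNIV"
  obtains \<phi> where "\<And>m::nat. \<phi> m \<in> H" "\<And>R. R > 0 \<Longrightarrow> \<exists>B. \<forall>m. nrm (\<phi> m) * R ^ m \<le> B"
    "\<And>g w. g \<in> H \<Longrightarrow> (\<lambda>m. ip g (\<phi> m) * w ^ m) sums ip g (k w)"
proof (rule gram_power_series_hermitian[OF k])
  let ?b = "\<lambda>n m. (a n m + conjugate (a m n)) / 2"
  have conj2: "conjugate (x / 2) = conjugate x / 2" for x :: 'k
    using conj_scaleR[of "1/2" x] by (simp add: scaleR_conv_of_real)
  show "conjugate (?b m n) = ?b n m" for n m by (simp add: conj2 conj_simps add.commute)
  fix z w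
  have "((\<lambda>(n, m). conjugate (a n m) * conjugate w ^ n * z ^ m) has_sum ip (k w) (k z)) UNIV"
    using has_sum_bounded_linear[OF bounded_linear_conjugate gram[of w z]]
    by (simp add: ip_sym[OF k k, symmetric] case_prod_unfold conj_simps)
  from has_sum_divide_const[OF has_sum_add[OF gram[of z w] has_sum_double_swap[OF this]], of 2]
  show "((\<lambda>(n, m). ?b n m * z ^ n * conjugate w ^ m) has_sum ip (k w) (k z)) UNIV"
    by (simp add: case_prod_unfold algebra_simps add_divide_distrib)
qed blast

end

section \<open>Taylor coefficients as inner products\<close>

lemma higher_deriv_power_series:
  fixes f :: "'k::{real_normed_field, banach} \<Rightarrow> 'k"
  assumes "\<And>x. (\<lambda>m. c m * x ^ m) sums f x"
  shows "(\<lambda>m. of_nat ((m + n) choose n) * c (m + n) * x ^ m) sums ((deriv ^^ n) f x / fact n)"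
proof -
  have "\<forall>x. (\<lambda>m. fact (m + n) / fact m * c (m + n) * x ^ m) sums (deriv ^^ n) f x"
  proof (induction n)
    case 0
    then show ?case using assms by simp
  next
    case (Suc n)
    define e where "e m = fact (m + n) / fact m * c (m + n)" for m
    have e: "(\<lambda>m. e m * x ^ m) sums (deriv ^^ n) f x" for x using Suc by (simp add: e_def)
    then have "(deriv ^^ n) f = (\<lambda>x. \<Sum>m. e m * x ^ m)" by (auto simp: sums_iff)
    then have D: "((deriv ^^ n) f has_field_derivative (\<Sum>m. diffs e m * x ^ m)) (at x)" for x
      using termdiffs_strong_converges_everywhere[of e x] e by (auto simp: sums_iff)
    have "(\<lambda>m. diffs e m * x ^ m) sums (deriv ^^ Suc n) f x" for x
      using summable_sums[OF termdiff_converges_all[of e x]] e DERIV_imp_deriv[OF D[of x]]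
      by (auto simp: sums_iff)
    moreover have "diffs e m = fact (m + Suc n) / fact m * c (m + Suc n)" for m
    proof -
      have "(1 + of_nat m :: 'k) \<noteq> 0" by (metis of_nat_Suc of_nat_neq_0)
      then show ?thesis by (simp add: diffs_def e_def)
    qed
    ultimately show ?case by simp
  qed
  then have "(\<lambda>m. fact (m + n) / fact m * c (m + n) * x ^ m / fact n) sums ((deriv ^^ n) f x / fact n)"
    by (intro sums_divide) simp
  moreover have "fact (m + n) / fact m * c (m + n) * x ^ m / fact n
      = of_nat ((m + n) choose n) * c (m + n) * x ^ m" for m
    by (simp add: binomial_fact)
  ultimately show ?thesis by simp
qed

context hilbert_space
begin

text \<open>The elements \<open>F w n\<close> represent the Taylor coefficients of \<open>x \<mapsto> ip f (k x)\<close> at \<open>w\<close>. They come from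
  differentiating \<open>k w = (\<Sum>m. conjugate w ^ m \<cdot> \<phi> m)\<close> termwise with respect to \<open>conjugate w\<close>:
  \<open>F w n = (\<Sum>m. ((m + n) choose n) * conjugate w ^ m \<cdot> \<phi> (m + n))\<close>. As the norms of \<open>\<phi> m\<close> decay faster than any
  geometric sequence, so do those of \<open>F w n\<close>, which is why jets are square summable and may be paired
  with any square summable sequence. The factor \<open>c\<close> in the derivative formula allows to pull constants out of
  iterated derivatives without a separate differentiability argument.\<close>

lemma jet_functionals:
  assumes k: "\<And>w. k w \<in> H"
    and gram: "\<And>z w. ((\<lambda>(n, m). a n m * z ^ n * conjugate w ^ m) has_sum ip (k w) (k z)) UNIV"
  obtains F where "\<And>w n. F w n \<in> H" "\<And>w. summable (\<lambda>n. nrm (F w n))"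
    "\<And>f c w n. f \<in> H \<Longrightarrow> (deriv ^^ n) (\<lambda>x. c * ip f (k x)) w / fact n = c * ip f (F w n)"
    "\<And>f w n. f \<in> H \<Longrightarrow>
      (deriv ^^ n) (\<lambda>u. ip (k (conjugate u)) f) (conjugate w) / fact n = ip (F w n) f"
proof -
  obtain \<phi> where \<phi>: "\<And>m::nat. \<phi> m \<in> H"
    and bound: "\<And>R. R > 0 \<Longrightarrow> \<exists>B. \<forall>m. nrm (\<phi> m) * R ^ m \<le> B"
    and expand: "\<And>g w. g \<in> H \<Longrightarrow> (\<lambda>m. ip g (\<phi> m) * w ^ m) sums ip g (k w)"
    using gram_power_series[OF k gram] by metis
  define X where "X w n m = scl (of_nat ((m + n) choose n) * conjugate w ^ m) (\<phi> (m + n))" for w n m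
  have X: "X w n m \<in> H" for w n m unfolding X_def by (intro mem \<phi>)
  have "\<exists>B. \<forall>n m. nrm (X w n m) \<le> B * (1 / 2) ^ n * (1 / 2) ^ m" for w
  proof -
    define r where "r = 1 + norm w"
    have r: "r \<ge> 1" "norm w \<le> r" by (auto simp: r_def)
    \<comment> \<open>Half of the factor 4 absorbs the binomial coefficient, the other half leaves the decay \<open>(1 / 2) ^ (m + n)\<close>.\<close>
    obtain B where B: "\<And>m. nrm (\<phi> m) * (4 * r) ^ m \<le> B" using bound[of "4 * r"] r by auto
    have "nrm (X w n m) \<le> B * (1 / 2) ^ n * (1 / 2) ^ m" for n m
    proof -
      have "nrm (X w n m) = real ((m + n) choose n) * norm w ^ m * nrm (\<phi> (m + n))"
        using \<phi> by (simp add: X_def nrm_scale norm_mult norm_power)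
      also have "\<dots> \<le> 2 ^ (m + n) * r ^ (m + n) * nrm (\<phi> (m + n))"
      proof (intro mult_right_mono mult_mono)
        show "real ((m + n) choose n) \<le> 2 ^ (m + n)"
          using binomial_le_pow2[of "m + n" n] of_nat_mono by fastforce
        show "norm w ^ m \<le> r ^ (m + n)"
          using r by (meson order_trans power_mono norm_ge_zero power_increasing le_add1)
      qed auto
      also have "\<dots> = (nrm (\<phi> (m + n)) * (4 * r) ^ (m + n)) * (1 / 2) ^ (m + n)"
      proof -
        have "(2::real) ^ (m + n) = 4 ^ (m + n) * (1 / 2) ^ (m + n)"
          unfolding power_mult_distrib[symmetric] by simp
        then show ?thesis by (simp add: power_mult_distrib)
      qed
      also have "\<dots> \<le> B * (1 / 2) ^ (m + n)"
        by (intro mult_right_mono B) simp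
      finally show ?thesis by (simp add: power_add mult_ac)
    qed
    then show ?thesis by blast
  qed
  then obtain B where B: "\<And>w n m. nrm (X w n m) \<le> B w * (1 / 2) ^ n * (1 / 2) ^ m" by metis
  have geo: "summable (\<lambda>m. B w * (1 / 2) ^ n * (1 / 2) ^ m)" for w and n :: nat
    by (intro summable_mult summable_geometric) simp
  have sX: "summable (\<lambda>m. nrm (X w n m))" for w n
    by (rule summable_comparison_test[OF _ geo[of w n]]) (use B in auto)
  have "\<exists>x. x \<in> H \<and> (\<forall>g\<in>H. (\<lambda>m. ip (X w n m) g) sums ip x g) \<and> nrm x \<le> (\<Sum>m. nrm (X w n m))" for w n
    using abs_convergent_series[OF X sX] by metis
  then obtain F where F: "\<And>w n. F w n \<in> H"
    and Fs: "\<And>w n g. g \<in> H \<Longrightarrow> (\<lambda>m. ip (X w n m) g) sums ip (F w n) g"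
    and Fn: "\<And>w n. nrm (F w n) \<le> (\<Sum>m. nrm (X w n m))"
    by metis
  have Fs: "(\<lambda>m. of_nat ((m + n) choose n) * ip (\<phi> (m + n)) g * conjugate w ^ m) sums ip (F w n) g"
    if "g \<in> H" for w n g
    using Fs[OF that, of w n] that \<phi> by (simp add: X_def ip_scale_left mult_ac)
  have Fs': "(\<lambda>m. of_nat ((m + n) choose n) * ip g (\<phi> (m + n)) * w ^ m) sums ip g (F w n)"
    if "g \<in> H" for w n g
  proof -
    have "conjugate (of_nat i) = (of_nat i :: 'k)" for i
      using conj_of_real[of "real i"] by simp
    then show ?thesis using conj_sums[OF Fs[OF that, of n w]] that \<phi> F
      by (simp add: conj_simps ip_sym[OF \<phi> that, symmetric] ip_sym[OF F that, symmetric])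
  qed
  show thesis
  proof (rule that[OF F])
    show "summable (\<lambda>n. nrm (F w n))" for w
    proof (rule summable_comparison_test)
      show "summable (\<lambda>n. 2 * B w * (1 / 2) ^ n)"
        by (intro summable_mult summable_geometric) simp
      have "nrm (F w n) \<le> 2 * B w * (1 / 2) ^ n" for n
      proof -
        have "(\<Sum>m. nrm (X w n m)) \<le> (\<Sum>m. B w * (1 / 2) ^ n * (1 / 2) ^ m)"
          by (intro suminf_le B sX geo)
        also have "\<dots> = 2 * B w * (1 / 2) ^ n"
          by (simp add: suminf_mult suminf_geometric)
        finally show ?thesis using Fn[of w n] by linarith
      qed
      then show "\<exists>N. \<forall>n\<ge>N. norm (nrm (F w n)) \<le> 2 * B w * (1 / 2) ^ n" by simp
    qed
    fix f w n assume f: "f \<in> H"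
    show "(deriv ^^ n) (\<lambda>x. c * ip f (k x)) w / fact n = c * ip f (F w n)" for c
    proof -
      have "(\<lambda>m. c * ip f (\<phi> m) * x ^ m) sums (c * ip f (k x))" for x
        using sums_mult[OF expand[OF f, of x], of c] by (simp add: mult.assoc)
      from higher_deriv_power_series[OF this, of n w] sums_mult[OF Fs'[OF f, of n w], of c]
      show ?thesis by (simp add: mult_ac sums_unique2)
    qed
    have "(\<lambda>m. ip (\<phi> m) f * u ^ m) sums ip (k (conjugate u)) f" for u
      using conj_sums[OF expand[OF f, of "conjugate u"]]
      by (simp add: conj_simps ip_sym[OF f \<phi>, symmetric] ip_sym[OF f k, symmetric])
    from higher_deriv_power_series[OF this, of n "conjugate w"] Fs[OF f, of n w]
    show "(deriv ^^ n) (\<lambda>u. ip (k (conjugate u)) f) (conjugate w) / fact n = ip (F w n) f"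
      by (rule sums_unique2)
  qed
qed

end

section \<open>The space of square summable sequences\<close>

lemma vec_ip_axis: "vec_ip x (axis i 1) = x $ i"
  unfolding vec_ip_def by (simp add: axis_def if_distrib[of conjugate] if_distrib[of "(*) _"] conj_one cong: if_cong)

lemma l2_ip_single:
  "l2_ip \<xi> (\<lambda>m. if m = n then axis i 1 else 0) = \<xi> n $ i"
proof -
  have "(\<lambda>m. vec_ip (\<xi> m) (if m = n then axis i 1 else 0)) sums (\<xi> n $ i)"
    using sums_single[of n "\<lambda>m. \<xi> m $ i"]
    by (auto simp: vec_ip_axis if_distrib[of "vec_ip _"] vec_ip_def[of _ 0] cong: if_cong)
  then show ?thesis by (simp add: l2_ip_def sums_iff)
qed

lemma single_in_l2: "(\<lambda>m. if m = n then x else 0) \<in> l2"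
  unfolding l2_def
  using summable_single[of n "\<lambda>_. (norm x)\<^sup>2"]
  by (simp add: if_distrib[of norm] if_distrib[of "\<lambda>x. x\<^sup>2"] cong: if_cong)

lemma l2_bounded:
  assumes "\<xi> \<in> l2"
  obtains B where "\<And>n. norm (\<xi> n) \<le> B"
proof -
  have s: "summable (\<lambda>n. (norm (\<xi> n))\<^sup>2)" using assms by (simp add: l2_def)
  have "norm (\<xi> n) \<le> sqrt (\<Sum>n. (norm (\<xi> n))\<^sup>2)" for n
    using sum_le_suminf[OF s, of "{n}"] by (intro real_le_rsqrt) auto
  then show thesis by (rule that)
qed

lemma summable_norm_imp_l2:
  assumes s: "summable (\<lambda>n. norm (\<xi> n))"
  shows "\<xi> \<in> l2"
proof -
  have "\<forall>\<^sub>F n in sequentially. norm (\<xi> n) < 1"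
    using order_tendstoD(2)[OF summable_LIMSEQ_zero[OF s]] by simp
  then have "\<forall>\<^sub>F n in sequentially. norm ((norm (\<xi> n))\<^sup>2) \<le> norm (\<xi> n)"
    by eventually_elim (simp add: power2_eq_square mult_left_le)
  from summable_comparison_test_ev[OF this s] show ?thesis by (simp add: l2_def)
qed

lemma module_l2_scale: "module (l2_scale :: 'k::real_or_complex \<Rightarrow> (nat \<Rightarrow> 'k ^ 'p) \<Rightarrow> _)"
  by unfold_locales (auto simp: l2_scale_def fun_eq_iff vec.scale_left_distrib vec.scale_right_distrib)

section \<open>The space of jets\<close>

text \<open>The whole theorem follows from the existence of elements \<open>F i z n\<close> that represent the entries of the
  jet: linearity of \<open>jet\<close>, square summability, and, since the Gram matrix of these elements is the jet
  kernel, also the kernel functions and their reproducing property.\<close>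

locale jet_rkhs = rkhs "(*s)" UNIV vec_ip "\<lambda>z w. (*v) (K z w)" H ip
  for K :: "'k::real_or_complex \<Rightarrow> 'k \<Rightarrow> 'k ^ 'p ^ 'p" and H ip +
  fixes F :: "'p \<Rightarrow> 'k \<Rightarrow> nat \<Rightarrow> 'k \<Rightarrow> 'k ^ 'p"
  assumes F_mem: "F i z n \<in> H"
    and F_summable: "summable (\<lambda>n. nrm (F i z n))"
    and jet_nth: "f \<in> H \<Longrightarrow> jet f z n $ i = ip f (F i z n)"
    and ip_F: "ip (F j w m) (F i z n) = jet_kernel_entry K n m z w $ i $ j"
begin

lemma jet_add: "f \<in> H \<Longrightarrow> g \<in> H \<Longrightarrow> jet (f + g) = jet f + jet g"
  by (simp add: fun_eq_iff vec_eq_iff jet_nth mem ip_add_left F_mem)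

lemma jet_diff: "f \<in> H \<Longrightarrow> g \<in> H \<Longrightarrow> jet (f - g) = jet f - jet g"
  by (simp add: fun_eq_iff vec_eq_iff jet_nth mem ip_diff_left F_mem)

lemma jet_scale: "f \<in> H \<Longrightarrow> jet (\<lambda>z. c *s f z) = (\<lambda>z. l2_scale c (jet f z))"
  using mem(3)[of f c] ip_scale_left[of f _ c]
  by (simp add: fun_eq_iff vec_eq_iff l2_scale_def jet_nth F_mem)

text \<open>The zeroth entry of the jet is the function itself.\<close>

lemma jet_eq_0_imp: "jet f = 0 \<Longrightarrow> f = 0"
proof -
  assume "jet f = 0"
  then have "jet f z 0 $ i = 0" for z i by simp
  then show "f = 0" by (simp add: jet_def fun_eq_iff vec_eq_iff)
qed

lemma jet_zero: "jet 0 = (0 :: 'k \<Rightarrow> nat \<Rightarrow> 'k ^ 'p)"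
  using jet_diff[OF mem(1) mem(1)] by simp

lemma jet_in_l2:
  assumes f: "f \<in> H"
  shows "jet f z \<in> l2"
proof (rule summable_norm_imp_l2, rule summable_comparison_test)
  show "summable (\<lambda>n. \<Sum>i\<in>UNIV. nrm f * nrm (F i z n))"
    by (intro summable_sum summable_mult F_summable)
  have "norm (jet f z n) \<le> (\<Sum>i\<in>UNIV. nrm f * nrm (F i z n))" for n
  proof -
    have "norm (jet f z n) \<le> (\<Sum>i\<in>UNIV. norm (jet f z n $ i))"
      unfolding norm_vec_def by (rule L2_set_le_sum) simp
    also have "\<dots> \<le> (\<Sum>i\<in>UNIV. nrm f * nrm (F i z n))"
      by (intro sum_mono) (simp add: jet_nth f F_mem Cauchy_Schwarz)
    finally show ?thesis .
  qed
  then show "\<exists>N. \<forall>n\<ge>N. norm (norm (jet f z n)) \<le> (\<Sum>i\<in>UNIV. nrm f * nrm (F i z n))" by simp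
qed

text \<open>The preimage is \<open>g = (\<Sum>m j. e m $ j \<cdot> F j w m)\<close>. Pairing \<open>f\<close> with it reproduces the jet of \<open>f\<close> at \<open>w\<close>, and
  pairing it with \<open>F i z n\<close> yields its own jet, whose entries are the rows of the jet kernel applied to \<open>e\<close>.\<close>

lemma jet_kernel_preimage:
  assumes e: "e \<in> l2"
  obtains g where "g \<in> H" "jet g = (\<lambda>z. jet_kernel K z w e)"
    "\<And>f. f \<in> H \<Longrightarrow> ip f g = l2_ip (jet f w) e"
proof -
  let ?scl = "\<lambda>c (f :: 'k \<Rightarrow> 'k ^ 'p) z. c *s f z"
  define X where "X m = (\<Sum>j\<in>UNIV. ?scl (e m $ j) (F j w m))" for m
  have X: "X m \<in> H" for m unfolding X_def by (intro mem F_mem)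
  obtain B where B: "\<And>m. norm (e m) \<le> B" using l2_bounded[OF e] by blast
  have sX: "summable (\<lambda>m. nrm (X m))"
  proof (rule summable_comparison_test)
    show "summable (\<lambda>m. \<Sum>j\<in>UNIV. B * nrm (F j w m))"
      by (intro summable_sum summable_mult F_summable)
    have "nrm (X m) \<le> (\<Sum>j\<in>UNIV. B * nrm (F j w m))" for m
    proof -
      have "nrm (X m) \<le> (\<Sum>j\<in>UNIV. nrm (?scl (e m $ j) (F j w m)))"
        unfolding X_def by (intro nrm_sum mem F_mem)
      also have "\<dots> \<le> (\<Sum>j\<in>UNIV. B * nrm (F j w m))"
        using order_trans[OF Finite_Cartesian_Product.norm_nth_le B]
        by (intro sum_mono) (simp add: nrm_scale F_mem mult_right_mono)
      finally show ?thesis .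
    qed
    then show "\<exists>N. \<forall>m\<ge>N. norm (nrm (X m)) \<le> (\<Sum>j\<in>UNIV. B * nrm (F j w m))" by simp
  qed
  have "\<exists>g. g \<in> H \<and> (\<forall>f\<in>H. (\<lambda>m. ip (X m) f) sums ip g f)"
    by (rule abs_convergent_series[OF X sX]) auto
  then obtain g where g: "g \<in> H" and gs: "\<And>f. f \<in> H \<Longrightarrow> (\<lambda>m. ip (X m) f) sums ip g f"
    by metis
  have ipX: "ip (X m) f = (\<Sum>j\<in>UNIV. e m $ j * ip (F j w m) f)" if "f \<in> H" for m f
    unfolding X_def using that by (simp add: ip_sum_left mem(3) F_mem ip_scale_left)
  have "ip f g = l2_ip (jet f w) e" if f: "f \<in> H" for f
  proof -
    have "conjugate (ip (X m) f) = vec_ip (jet f w m) (e m)" for m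
      by (simp add: ipX f conj_simps vec_ip_def jet_nth ip_sym[OF F_mem f, symmetric] mult.commute)
    then have "(\<lambda>m. vec_ip (jet f w m) (e m)) sums ip f g"
      using conj_sums[OF gs[OF f]] by (simp add: ip_sym[OF g f, symmetric])
    then show ?thesis by (simp add: l2_ip_def sums_iff)
  qed
  moreover have "jet g = (\<lambda>z. jet_kernel K z w e)"
  proof (intro ext)
    fix z n
    have "(\<lambda>m. jet_kernel_entry K n m z w *v e m) sums jet g z n"
      unfolding sums_def
    proof (rule vec_tendstoI)
      fix i
      have "ip (X m) (F i z n) = (jet_kernel_entry K n m z w *v e m) $ i" for m
        by (simp add: ipX F_mem ip_F matrix_vector_mult_def mult.commute)
      then show "(\<lambda>M. (\<Sum>m<M. jet_kernel_entry K n m z w *v e m) $ i) \<longlonglongrightarrow> jet g z n $ i"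
        using gs[OF F_mem, of i z n] by (simp add: sums_def jet_nth g)
    qed
    then show "jet g z n = jet_kernel K z w e n"
      by (simp add: jet_kernel_def sums_iff)
  qed
  ultimately show thesis using that g by blast
qed

lemma hilbert_space_on_jets:
  assumes ipJ: "\<And>f g. f \<in> H \<Longrightarrow> g \<in> H \<Longrightarrow> ipJ (jet f) (jet g) = ip f g"
  shows "hilbert_space_on (\<lambda>c f z. l2_scale c (f z)) (jet ` H) ipJ"
proof -
  interpret J: module "\<lambda>c (f :: 'k \<Rightarrow> nat \<Rightarrow> 'k ^ 'p) z. l2_scale c (f z)"
    by (rule module_pointwise[OF module_l2_scale])
  show ?thesis
    unfolding hilbert_space_on_def
  proof (intro conjI ballI allI impI; (elim imageE, hypsubst)?)
    show "J.subspace (jet ` H)"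
    proof (rule J.subspaceI)
      show "0 \<in> jet ` H" by (metis imageI jet_zero mem(1))
      show "x + y \<in> jet ` H" if "x \<in> jet ` H" "y \<in> jet ` H" for x y
        using that by (auto simp: jet_add[symmetric] mem)
      show "(\<lambda>z. l2_scale c (x z)) \<in> jet ` H" if "x \<in> jet ` H" for c x
        using that by (auto simp: jet_scale[symmetric] mem)
    qed
    fix X :: "nat \<Rightarrow> 'k \<Rightarrow> nat \<Rightarrow> 'k ^ 'p"
    assume X: "(\<forall>n. X n \<in> jet ` H) \<and>
      (\<forall>\<epsilon>>0. \<exists>N. \<forall>m\<ge>N. \<forall>n\<ge>N. sqrt (norm (ipJ (X m - X n) (X m - X n))) < \<epsilon>)"
    have "\<forall>n. \<exists>y. y \<in> H \<and> X n = jet y" using conjunct1[OF X] by blast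
    then obtain Y where Y: "\<And>n. Y n \<in> H" "\<And>n. X n = jet (Y n)" by metis
    have nrmJ: "sqrt (norm (ipJ (jet f - jet g) (jet f - jet g))) = nrm (f - g)"
      if "f \<in> H" "g \<in> H" for f g
      using that by (simp add: jet_diff[symmetric] ipJ mem nrm_def)
    obtain y where "y \<in> H" "(\<lambda>n. nrm (Y n - y)) \<longlonglongrightarrow> 0"
      using complete[of Y] conjunct2[OF X] Y by (auto simp: nrmJ)
    then show "\<exists>x\<in>jet ` H. (\<lambda>n. sqrt (norm (ipJ (X n - x) (X n - x)))) \<longlonglongrightarrow> 0"
      using Y by (auto simp: nrmJ)
  next
    fix f g h assume "f \<in> H" "g \<in> H" "h \<in> H"
    then show "ipJ (jet f + jet g) (jet h) = ipJ (jet f) (jet h) + ipJ (jet g) (jet h)"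
      by (simp add: jet_add[symmetric] ipJ mem ip_add_left)
  next
    fix c f h assume "f \<in> H" "h \<in> H"
    then show "ipJ (\<lambda>z. l2_scale c (jet f z)) (jet h) = c * ipJ (jet f) (jet h)"
      using ip_scale_left[of f h c] by (simp add: jet_scale[symmetric] ipJ mem)
  next
    fix f g assume "f \<in> H" "g \<in> H"
    then show "ipJ (jet g) (jet f) = conjugate (ipJ (jet f) (jet g))"
      by (simp add: ipJ ip_sym[symmetric])
  next
    fix f assume "f \<in> H"
    then show "\<exists>r\<ge>0. ipJ (jet f) (jet f) = of_real r"
      using ip_self[of f] by (auto simp: ipJ simp del: of_real_power intro!: exI[of _ "(nrm f)\<^sup>2"])
  next
    fix f assume "f \<in> H" "ipJ (jet f) (jet f) = 0"
    then show "jet f = 0" by (simp add: ipJ ip_eq_0_iff jet_zero)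
  qed
qed

lemma is_rkhs_jets:
  assumes ipJ: "\<And>f g. f \<in> H \<Longrightarrow> g \<in> H \<Longrightarrow> ipJ (jet f) (jet g) = ip f g"
  shows "is_rkhs l2_scale l2 l2_ip (jet_kernel K) (jet ` H) ipJ"
  unfolding is_rkhs_def
proof (intro conjI ballI allI)
  show "hilbert_space_on (\<lambda>c f z. l2_scale c (f z)) (jet ` H) ipJ"
    by (rule hilbert_space_on_jets) (rule ipJ)
next
  show "f z \<in> l2" if "f \<in> jet ` H" for f z using that jet_in_l2 by auto
next
  show "(\<lambda>z. jet_kernel K z w e) \<in> jet ` H" if "e \<in> l2" for w e
    using jet_kernel_preimage[OF that, of w] by (metis imageI)
next
  fix f w and e :: "nat \<Rightarrow> 'k ^ 'p" assume "f \<in> jet ` H" and e: "e \<in> l2"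
  then obtain f' where f': "f' \<in> H" "f = jet f'" by blast
  obtain g where "g \<in> H" "jet g = (\<lambda>z. jet_kernel K z w e)"
    "\<And>f. f \<in> H \<Longrightarrow> ip f g = l2_ip (jet f w) e"
    using jet_kernel_preimage[OF e, of w] by blast
  then show "ipJ f (\<lambda>z. jet_kernel K z w e) = l2_ip (f w) e"
    using f' ipJ by metis
qed

lemma inj_on_jet: "inj_on jet H"
proof (rule inj_onI)
  fix f g assume "f \<in> H" "g \<in> H" "jet f = jet g"
  then have "jet (f - g) = 0" by (simp add: jet_diff)
  then show "f = g" using jet_eq_0_imp by fastforce
qed

end

lemma rkhs_jetsI:
  fixes K :: "'k::real_or_complex \<Rightarrow> 'k \<Rightarrow> 'k ^ 'p ^ 'p"
  assumes "is_rkhs l2_scale l2 l2_ip (jet_kernel K) HJ ipJ"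
  shows "rkhs l2_scale l2 l2_ip (jet_kernel K) HJ ipJ"
proof (intro rkhs.intro rkhs_axioms.intro module_l2_scale assms)
  fix x y :: "nat \<Rightarrow> 'k ^ 'p"
  assume "\<And>e. e \<in> l2 \<Longrightarrow> l2_ip x e = l2_ip y e"
  from this[OF single_in_l2] have "x n $ i = y n $ i" for n i
    by (metis l2_ip_single)
  then show "x = y" by (simp add: fun_eq_iff vec_eq_iff)
qed

text \<open>For a fixed index \<open>j\<close> the kernel columns \<open>k j w = (\<lambda>z. K z w *v axis j 1)\<close> have the Gram kernel \<open>K z w $ j $ j\<close>, a double power
  series; so the diagonal entries of the kernel provide the jet functionals. The off-diagonal entries
  of the jet kernel then arise by differentiating \<open>ip (k j w) (k i z) = K z w $ i $ j\<close> in the two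
  variables, one after the other.\<close>

lemma rkhs_entire_jet_functionals:
  fixes K :: "'k::real_or_complex \<Rightarrow> 'k \<Rightarrow> 'k ^ 'p ^ 'p"
  assumes "is_rkhs (*s) UNIV vec_ip (\<lambda>z w. (*v) (K z w)) H ip" and "entire_in_z_conj_w K"
  obtains F where "jet_rkhs K H ip F"
proof -
  interpret rkhs "(*s)" UNIV vec_ip "\<lambda>z w. (*v) (K z w)" H ip
  proof (intro rkhs.intro rkhs_axioms.intro assms)
    show "module ((*s) :: 'k \<Rightarrow> 'k ^ 'p \<Rightarrow> _)" by (rule vec.module_axioms)
    show "x = y" if "\<And>e. e \<in> UNIV \<Longrightarrow> vec_ip x e = vec_ip y e" for x y :: "'k ^ 'p"
      using that[of "axis _ 1"] by (simp add: vec_ip_axis vec_eq_iff)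
  qed
  define k where "k j w = (\<lambda>z. K z w *v axis j 1)" for j w
  have k: "k j w \<in> H" for j w unfolding k_def by (rule kernel_mem) simp
  have ip_k: "ip f (k j w) = f w $ j" if "f \<in> H" for f j w
    using reproducing[OF that, of "axis j 1" w] by (simp add: k_def vec_ip_axis)
  have k_nth: "k j w z $ i = K z w $ i $ j" for j w z i
    by (simp add: k_def matrix_vector_mult_def axis_def if_distrib cong: if_cong)
  obtain a where a: "\<And>z w i j. ((\<lambda>(n, m). a n m $ i $ j * z ^ n * conjugate w ^ m) has_sum K z w $ i $ j) UNIV"
    using assms(2) unfolding entire_in_z_conj_w_def by blast
  have gram: "((\<lambda>(n, m). a n m $ j $ j * z ^ n * conjugate w ^ m) has_sum ip (k j w) (k j z)) UNIV" for j z w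
    using a by (simp add: ip_k k k_nth)
  have "\<exists>F. (\<forall>w n. F w n \<in> H) \<and> (\<forall>w. summable (\<lambda>n. nrm (F w n))) \<and>
    (\<forall>f c w n. f \<in> H \<longrightarrow> (deriv ^^ n) (\<lambda>x. c * ip f (k j x)) w / fact n = c * ip f (F w n)) \<and>
    (\<forall>f w n. f \<in> H \<longrightarrow>
      (deriv ^^ n) (\<lambda>u. ip (k j (conjugate u)) f) (conjugate w) / fact n = ip (F w n) f)" for j
  proof (rule jet_functionals[OF k gram[where j = j]], goal_cases)
    case (1 F)
    then show ?case by (intro exI[of _ F] conjI allI impI)
  qed
  then obtain F where F: "\<And>j w n. F j w n \<in> H" and Fs: "\<And>j w. summable (\<lambda>n. nrm (F j w n))"
    and derivF: "\<And>j f c w n. f \<in> H \<Longrightarrow>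
      (deriv ^^ n) (\<lambda>x. c * ip f (k j x)) w / fact n = c * ip f (F j w n)"
    and derivF': "\<And>j f w n. f \<in> H \<Longrightarrow>
      (deriv ^^ n) (\<lambda>u. ip (k j (conjugate u)) f) (conjugate w) / fact n = ip (F j w n) f"
    by metis
  have "jet_rkhs K H ip F"
  proof (intro jet_rkhs.intro jet_rkhs_axioms.intro F Fs rkhs_axioms)
    show "jet f z n $ i = ip f (F i z n)" if "f \<in> H" for f z n i
      using derivF[OF that, of n 1 i z] by (simp add: jet_def ip_k that)
    fix j w m i z n
    have "ip (k j (conjugate u)) (k i x) = K x (conjugate u) $ i $ j" for u x
      by (simp add: ip_k k k_nth)
    then have "(deriv ^^ m) (\<lambda>u. K x (conjugate u) $ i $ j) (conjugate w) = fact m * ip (F j w m) (k i x)" for x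
      using derivF'[OF k, of m j i x w] by (simp add: field_simps)
    then have "jet_kernel_entry K n m z w $ i $ j
        = (deriv ^^ n) (\<lambda>x. fact m * ip (F j w m) (k i x)) z / (fact m * fact n)"
      by (simp add: jet_kernel_entry_def)
    also have "\<dots> = ip (F j w m) (F i z n)"
      using derivF[OF F, of n "fact m" j w m i z] by (simp add: field_simps)
    finally show "ip (F j w m) (F i z n) = jet_kernel_entry K n m z w $ i $ j" ..
  qed
  then show thesis by (rule that)
qed

theorem theorem3p4:
  fixes K :: "'k::real_or_complex \<Rightarrow> 'k \<Rightarrow> 'k ^ 'p ^ 'p"
    and H :: "('k \<Rightarrow> 'k ^ 'p) set"
    and ip :: "('k \<Rightarrow> 'k ^ 'p) \<Rightarrow> ('k \<Rightarrow> 'k ^ 'p) \<Rightarrow> 'k"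
    and HJ :: "('k \<Rightarrow> nat \<Rightarrow> 'k ^ 'p) set"
    and ipJ :: "('k \<Rightarrow> nat \<Rightarrow> 'k ^ 'p) \<Rightarrow> ('k \<Rightarrow> nat \<Rightarrow> 'k ^ 'p) \<Rightarrow> 'k"
  assumes "positive_definite UNIV vec_ip (\<lambda>z w. (*v) (K z w))"
    and "entire_in_z_conj_w K"
    and "is_rkhs (*s) UNIV vec_ip (\<lambda>z w. (*v) (K z w)) H ip"
  shows "is_rkhs l2_scale l2 l2_ip (jet_kernel K) HJ ipJ \<longleftrightarrow>
           HJ = jet ` H \<and> (\<forall>f\<in>H. \<forall>g\<in>H. ipJ (jet f) (jet g) = ip f g)"
proof -
  obtain F where "jet_rkhs K H ip F"
    using rkhs_entire_jet_functionals[OF assms(3,2)] .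
  then interpret jet_rkhs K H ip F .
  show ?thesis
  proof
    assume J: "is_rkhs l2_scale l2 l2_ip (jet_kernel K) HJ ipJ"
    \<comment> \<open>On the space of jets the transported inner product is well defined because \<open>jet\<close> is injective.\<close>
    define ip' where "ip' u v = ip (the_inv_into H jet u) (the_inv_into H jet v)" for u v
    have ip': "ip' (jet f) (jet g) = ip f g" if "f \<in> H" "g \<in> H" for f g
      using that by (simp add: ip'_def the_inv_into_f_f inj_on_jet)
    have J': "is_rkhs l2_scale l2 l2_ip (jet_kernel K) (jet ` H) ip'"
      by (rule is_rkhs_jets) (rule ip')
    note unique = rkhs_unique[OF rkhs_jetsI[OF J] rkhs_jetsI[OF J']]
    have "ipJ (jet f) (jet g) = ip f g" if "f \<in> H" "g \<in> H" for f g
      using unique(2)[of "jet f" "jet g"] ip'[OF that] that by (simp add: unique(1))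
    then show "HJ = jet ` H \<and> (\<forall>f\<in>H. \<forall>g\<in>H. ipJ (jet f) (jet g) = ip f g)"
      using unique(1) by blast
  qed (auto intro: is_rkhs_jets)
qed

end
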